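(* Let $A$ be a Dedekind domain that is not a field, with field of fractions $K$, let $L/K$ be a finite separable field extension, and let $B$ be the integral closure of $A$ in $L$. Then every ideal class of $B$ contains an ideal of degree one (over $A$).
   Context: $B$ is a Dedekind domain, and ideal classes are the elements of its ideal class group. A proper ideal $\mathfrak{b}$ of $B$ is said to be of degree one (over $A$) if $A+\mathfrak{b}=B$; equivalently, if the map $A/(A\cap\mathfrak{b})\to B/\mathfrak{b}$ induced by the inclusion $A\to B$ is an isomorphism.
   Formalization: "Proper ideal" in the definition of degree one is read as integral ideal, so b = B is allowed; with b ≠ B the claim fails for the trivial class, e.g. A = Z localized at 3, L = Q(i). Only the principal class is affected. *)

theory Defs
  imports "HOL-Algebra.Algebra" "HOL-Algebra.Algebraic_Closure_Type"
begin

text \<open>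
  The top field \<open>L\<close> is the type \<open>'l\<close>; the rings \<open>A\<close>, \<open>B\<close> and the field \<open>K\<close> are subsets of it,
  viewed as rings with the operations of \<open>'l\<close>.
\<close>

abbreviation ambient :: "'l::field ring" where
  "ambient \<equiv> ring_of_type_algebra"

definition ring_on :: "'l::field set \<Rightarrow> 'l ring" where
  "ring_on S = ambient\<lparr>carrier := S\<rparr>"

definition fractions :: "'l::field set \<Rightarrow> 'l set" where
  "fractions R = {a / b | a b. a \<in> R \<and> b \<in> R \<and> b \<noteq> 0}"

definition polys_over :: "'l::field set \<Rightarrow> 'l poly set" where
  "polys_over R = {p. \<forall>i. Polynomial.coeff p i \<in> R}"

definition integral_over :: "'l::field set \<Rightarrow> 'l \<Rightarrow> bool" where
  "integral_over R x \<longleftrightarrow>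
     (\<exists>p \<in> polys_over R. Polynomial.lead_coeff p = 1 \<and> poly p x = 0)"

definition integral_closure :: "'l::field set \<Rightarrow> 'l set" where
  "integral_closure R = {x. integral_over R x}"

text \<open>Fields are Dedekind domains under this definition.\<close>

definition dedekind_domain :: "'l::field set \<Rightarrow> bool" where
  "dedekind_domain R \<longleftrightarrow>
     subring R ambient \<and>
     noetherian_domain (ring_on R) \<and>
     (\<forall>x \<in> fractions R. integral_over R x \<longrightarrow> x \<in> R) \<and>
     (\<forall>P. primeideal P (ring_on R) \<and> P \<noteq> {0} \<longrightarrow> maximalideal P (ring_on R))"

definition is_minimal_poly :: "'l::field set \<Rightarrow> 'l \<Rightarrow> 'l poly \<Rightarrow> bool" where
  "is_minimal_poly K x p \<longleftrightarrow>
     p \<in> polys_over K \<and> Polynomial.lead_coeff p = 1 \<and> poly p x = 0 \<and>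
     (\<forall>q \<in> polys_over K. q \<noteq> 0 \<and> poly q x = 0 \<longrightarrow> Polynomial.degree p \<le> Polynomial.degree q)"

text \<open>
  Separability asks that the minimal polynomial have no repeated root in an algebraic closure of
  \<open>K\<close>. The type \<open>'l alg_closure\<close> serves as one, since \<open>L\<close> is algebraic over \<open>K\<close>.
\<close>

definition separable_element :: "'l::field set \<Rightarrow> 'l \<Rightarrow> bool" where
  "separable_element K x \<longleftrightarrow>
     (\<exists>p. is_minimal_poly K x p \<and> rsquarefree (map_poly to_ac p))"

definition finite_separable_extension :: "'l::field set \<Rightarrow> bool" where
  "finite_separable_extension K \<longleftrightarrow>
     subfield K ambient \<and>
     ring.finite_dimension ambient K (UNIV :: 'l set) \<and>
     (\<forall>x. separable_element K x)"

text \<open>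
  For Dedekind \<open>R\<close> the nonzero fractional ideals form a group, and the classes below are the cosets
  of the principal ones. A class is thus a set of fractional ideals of \<open>R\<close>.
\<close>

definition fractional_ideal :: "'l::field set \<Rightarrow> 'l set \<Rightarrow> bool" where
  "fractional_ideal R I \<longleftrightarrow>
     additive_subgroup I ambient \<and> I \<subseteq> fractions R \<and>
     (\<forall>r \<in> R. \<forall>x \<in> I. r * x \<in> I) \<and>
     (\<exists>d \<in> R. d \<noteq> 0 \<and> (\<forall>x \<in> I. d * x \<in> R))"

definition fractional_ideal_group :: "'l::field set \<Rightarrow> 'l set monoid" where
  "fractional_ideal_group R =
     \<lparr>carrier = {I. fractional_ideal R I \<and> I \<noteq> {0}},
      monoid.mult = ideal_prod ambient,
      one = R\<rparr>"

definition principal_fractional_ideals :: "'l::field set \<Rightarrow> 'l set set" where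
  "principal_fractional_ideals R = {(\<lambda>r. x * r) ` R | x. x \<in> fractions R \<and> x \<noteq> 0}"

definition ideal_class_group :: "'l::field set \<Rightarrow> 'l set set monoid" where
  "ideal_class_group R = fractional_ideal_group R Mod principal_fractional_ideals R"

text \<open>
  ``Proper ideal'' is read as integral ideal (contained in \<open>B\<close>, as opposed to fractional), so that
  \<open>\<bb> = B\<close> is allowed. This matters: for \<open>A\<close> the localization of the integers at 3 and \<open>L\<close> the
  Gaussian rationals, every ideal other than \<open>B\<close> lies in \<open>3 B\<close>, and \<open>A + 3 B\<close> is not \<open>B\<close>, although
  the trivial class of course contains \<open>B\<close> itself.
\<close>

definition degree_one_ideal :: "'l::field set \<Rightarrow> 'l set \<Rightarrow> 'l set \<Rightarrow> bool" where
  "degree_one_ideal A B \<bb> \<longleftrightarrow> ideal \<bb> (ring_on B) \<and> A <+>\<^bsub>ambient\<^esub> \<bb> = B"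

end

theory Submission
  imports Defs "Jordan_Normal_Form.Char_Poly"
begin

text \<open>
  Represent the class by a fractional ideal \<open>J\<close> of \<open>B\<close> with \<open>1 \<in> J\<close>, and look for \<open>x\<close> such that the ideal
  \<open>x J \<subseteq> B\<close> has degree one. Since \<open>x \<in> x J\<close>, we have \<open>A[x] \<subseteq> A + x J\<close>. So if \<open>x\<close> generates \<open>L\<close> over \<open>K\<close>, and
  \<open>d\<close> is a nonzero element of \<open>A\<close> with \<open>d B \<subseteq> A[x]\<close>, it is enough that \<open>x J\<close> be coprime to \<open>d\<close>: then
  \<open>B = x J + d B = A + x J\<close>.

  As \<open>J\<close> is locally principal, there is \<open>\<theta>\<close> with \<open>\<theta> J \<subseteq> B\<close> coprime to a prescribed \<open>m \<in> A\<close>, and \<open>\<theta>\<close> can be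
  moved by multiples of a fixed primitive element until it is primitive itself. Fix \<open>d\<close> with
  \<open>d B \<subseteq> A[\<theta>]\<close> and a monic \<open>f\<close> over \<open>A\<close> with \<open>f(\<theta>) = 0\<close>, and put \<open>x = \<theta> - a\<close> with \<open>a \<in> A\<close>. Then \<open>A[x] = A[\<theta>]\<close>,
  and \<open>x\<close> divides \<open>f(a)\<close> in \<open>B\<close>. If \<open>a\<close> is a suitable multiple of \<open>m\<close>, then \<open>x J\<close> remains coprime to \<open>m\<close>, and
  at the finitely many primes that contain \<open>d\<close> but not \<open>m\<close> it suffices that \<open>f(a)\<close> be a unit. Such an \<open>a\<close>
  exists by the Chinese remainder theorem as soon as those primes have residue fields with more
  elements than the degree of \<open>f\<close>. This degree is bounded independently of \<open>\<theta>\<close> by the number of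
  generators of \<open>B\<close>, and the primes with small residue field all contain one nonzero element of \<open>A\<close>,
  which \<open>m\<close> is chosen to be divisible by.
\<close>

section \<open>Subrings of a field, spans and integrality\<close>

text \<open>Rings are plain subsets of one ambient field, so that all arithmetic is that of the type
  class. The carrier-based structures of the definitions are reached only in the last
  section.\<close>

locale field_subring =
  fixes R :: "'a::field set"
  assumes one_mem [simp, intro]: "1 \<in> R"
    and diff_mem [intro]: "x \<in> R \<Longrightarrow> y \<in> R \<Longrightarrow> x - y \<in> R"
    and mult_mem [intro]: "x \<in> R \<Longrightarrow> y \<in> R \<Longrightarrow> x * y \<in> R"
begin

lemma zero_mem [simp, intro]: "0 \<in> R"
  using diff_mem[of 1 1] by simp

lemma uminus_mem [intro]: "x \<in> R \<Longrightarrow> - x \<in> R"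
  using diff_mem[of 0 x] by simp

lemma add_mem [intro]: "x \<in> R \<Longrightarrow> y \<in> R \<Longrightarrow> x + y \<in> R"
  using diff_mem[of x "- y"] by auto

lemma power_mem [intro]: "x \<in> R \<Longrightarrow> x ^ n \<in> R"
  by (induction n) auto

lemma sum_mem: "(\<And>i. i \<in> S \<Longrightarrow> f i \<in> R) \<Longrightarrow> sum f S \<in> R"
  by (induction S rule: infinite_finite_induct) auto

lemma prod_mem: "(\<And>i. i \<in> S \<Longrightarrow> f i \<in> R) \<Longrightarrow> prod f S \<in> R"
  by (induction S rule: infinite_finite_induct) auto

end

section \<open>Polynomials over a subring and division by monic polynomials\<close>

lemma polys_overD: "p \<in> polys_over R \<Longrightarrow> Polynomial.coeff p i \<in> R"
  by (simp add: polys_over_def)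

lemma polys_over_mono: "R \<subseteq> S \<Longrightarrow> polys_over R \<subseteq> polys_over S"
  by (auto simp: polys_over_def)

lemma degree_pos_of_monic_root:
  fixes p :: "'a::field poly"
  assumes "Polynomial.lead_coeff p = 1" "poly p x = 0"
  shows "Polynomial.degree p > 0"
proof (rule ccontr)
  assume "\<not> Polynomial.degree p > 0"
  then have "p = [:1:]" using assms(1) by (auto elim!: degree_eq_zeroE)
  then show False using assms(2) by simp
qed

context field_subring
begin

lemma polys_pCons [intro]: "a \<in> R \<Longrightarrow> p \<in> polys_over R \<Longrightarrow> pCons a p \<in> polys_over R"
  by (auto simp: polys_over_def coeff_pCons split: nat.split)

lemma polys_pCons_iff: "pCons a p \<in> polys_over R \<longleftrightarrow> a \<in> R \<and> p \<in> polys_over R"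
proof
  assume h: "pCons a p \<in> polys_over R"
  have "Polynomial.coeff p i \<in> R" for i
    using polys_overD[OF h, of "Suc i"] by simp
  then show "a \<in> R \<and> p \<in> polys_over R"
    using polys_overD[OF h, of 0] by (auto simp: polys_over_def)
qed auto

lemma polys_zero [simp, intro]: "0 \<in> polys_over R"
  by (auto simp: polys_over_def)

lemma polys_one [simp, intro]: "1 \<in> polys_over R"
  by (auto simp: polys_over_def)

lemma polys_add [intro]: "p \<in> polys_over R \<Longrightarrow> q \<in> polys_over R \<Longrightarrow> p + q \<in> polys_over R"
  by (auto simp: polys_over_def)

lemma polys_diff [intro]: "p \<in> polys_over R \<Longrightarrow> q \<in> polys_over R \<Longrightarrow> p - q \<in> polys_over R"
  by (auto simp: polys_over_def)

lemma polys_uminus [intro]: "p \<in> polys_over R \<Longrightarrow> - p \<in> polys_over R"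
  by (auto simp: polys_over_def)

lemma polys_smult [intro]: "a \<in> R \<Longrightarrow> p \<in> polys_over R \<Longrightarrow> Polynomial.smult a p \<in> polys_over R"
  by (auto simp: polys_over_def)

lemma polys_mult [intro]: "p \<in> polys_over R \<Longrightarrow> q \<in> polys_over R \<Longrightarrow> p * q \<in> polys_over R"
  by (auto simp: polys_over_def coeff_mult intro!: sum_mem)

lemma polys_sum: "(\<And>i. i \<in> S \<Longrightarrow> f i \<in> polys_over R) \<Longrightarrow> sum f S \<in> polys_over R"
  by (induction S rule: infinite_finite_induct) auto

lemma polys_prod: "(\<And>i. i \<in> S \<Longrightarrow> f i \<in> polys_over R) \<Longrightarrow> prod f S \<in> polys_over R"
  by (induction S rule: infinite_finite_induct) auto

lemma polys_pcompose [intro]: "p \<in> polys_over R \<Longrightarrow> q \<in> polys_over R \<Longrightarrow> pcompose p q \<in> polys_over R"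
  by (induction p) (auto simp: polys_pCons_iff pcompose_pCons)

lemma polys_pderiv [intro]: "p \<in> polys_over R \<Longrightarrow> pderiv p \<in> polys_over R"
  by (induction p) (auto simp: polys_pCons_iff pderiv_pCons)

lemma poly_mem [intro]: "p \<in> polys_over R \<Longrightarrow> x \<in> R \<Longrightarrow> poly p x \<in> R"
  by (induction p) (auto simp: polys_pCons_iff)

text \<open>Long division needs no denominators when the divisor is monic. The bound on the
  remainder is stated by coefficients because a divisor of degree 0 must leave remainder 0, which a
  degree bound could not express.\<close>

lemma monic_division:
  assumes "m \<in> polys_over R" "Polynomial.lead_coeff m = 1" "p \<in> polys_over R"
  obtains q r where "q \<in> polys_over R" "r \<in> polys_over R" "p = q * m + r"
    "\<And>i. i \<ge> Polynomial.degree m \<Longrightarrow> Polynomial.coeff r i = 0"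
proof -
  have "\<exists>q r. q \<in> polys_over R \<and> r \<in> polys_over R \<and> p = q * m + r \<and>
         (\<forall>i \<ge> Polynomial.degree m. Polynomial.coeff r i = 0)"
    using assms(3)
  proof (induction p)
    case 0
    show ?case by (rule exI[of _ 0], rule exI[of _ 0]) auto
  next
    case (pCons a p)
    then obtain q r where qr: "q \<in> polys_over R" "r \<in> polys_over R" "p = q * m + r"
      and r0: "\<And>i. i \<ge> Polynomial.degree m \<Longrightarrow> Polynomial.coeff r i = 0"
      by (auto simp: polys_pCons_iff)
    have a: "a \<in> R" using pCons.prems by (simp add: polys_pCons_iff)
    \<comment> \<open>Passing from the remainder \<open>r\<close> to \<open>a + X r\<close> can
      create only one forbidden coefficient, the one in the degree of \<open>m\<close>. Subtracting
      \<open>c\<close> times \<open>m\<close> removes it.\<close>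
    define c where "c = Polynomial.coeff (pCons a r) (Polynomial.degree m)"
    have ar: "pCons a r \<in> polys_over R" using a qr by auto
    have c: "c \<in> R" unfolding c_def using ar by (rule polys_overD)
    have "Polynomial.coeff (pCons a r - Polynomial.smult c m) i = 0" if "i \<ge> Polynomial.degree m" for i
    proof (cases "i = Polynomial.degree m")
      case True
      then show ?thesis using assms(2) by (simp add: c_def)
    next
      case False
      then have "i > Polynomial.degree m" using that by simp
      then show ?thesis by (cases i) (auto simp: r0 coeff_eq_0)
    qed
    moreover have "pCons a p = (pCons c q) * m + (pCons a r - Polynomial.smult c m)"
      by (simp add: qr(3) algebra_simps)
    moreover have "pCons c q \<in> polys_over R" "pCons a r - Polynomial.smult c m \<in> polys_over R"
      using c qr ar assms by auto
    ultimately show ?case by blast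
  qed
  then show ?thesis using that by blast
qed

end

section \<open>Spans and submodules\<close>

inductive_set span_over :: "'a::field set \<Rightarrow> 'a set \<Rightarrow> 'a set" for R W where
  span_over_zero [simp, intro]: "0 \<in> span_over R W"
| span_over_step: "r \<in> R \<Longrightarrow> w \<in> W \<Longrightarrow> v \<in> span_over R W \<Longrightarrow> r * w + v \<in> span_over R W"

text \<open>One notion serves for ideals (submodules contained in \<open>R\<close>), fractional
  ideals and finitely generated modules. Negatives come from scaling by -1 when \<open>R\<close> is
  a subring.\<close>

definition submodule_over :: "'a::field set \<Rightarrow> 'a set \<Rightarrow> bool" where
  "submodule_over R M \<longleftrightarrow> 0 \<in> M \<and> (\<forall>x\<in>M. \<forall>y\<in>M. x + y \<in> M) \<and> (\<forall>r\<in>R. \<forall>x\<in>M. r * x \<in> M)"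

lemma submodule_overI:
  assumes "0 \<in> M" "\<And>x y. x \<in> M \<Longrightarrow> y \<in> M \<Longrightarrow> x + y \<in> M"
    "\<And>r x. r \<in> R \<Longrightarrow> x \<in> M \<Longrightarrow> r * x \<in> M"
  shows "submodule_over R M"
  using assms by (auto simp: submodule_over_def)

lemma submodule_zero: "submodule_over R M \<Longrightarrow> 0 \<in> M"
  and submodule_add: "submodule_over R M \<Longrightarrow> x \<in> M \<Longrightarrow> y \<in> M \<Longrightarrow> x + y \<in> M"
  and submodule_scale: "submodule_over R M \<Longrightarrow> r \<in> R \<Longrightarrow> x \<in> M \<Longrightarrow> r * x \<in> M"
  by (auto simp: submodule_over_def)

lemma submodule_sum: "submodule_over R M \<Longrightarrow> (\<And>i. i \<in> S \<Longrightarrow> f i \<in> M) \<Longrightarrow> sum f S \<in> M"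
  by (induction S rule: infinite_finite_induct) (auto simp: submodule_zero submodule_add)

lemma submodule_antimono: "submodule_over S M \<Longrightarrow> R \<subseteq> S \<Longrightarrow> submodule_over R M"
  by (auto simp: submodule_over_def)

lemma span_over_least: "submodule_over R M \<Longrightarrow> W \<subseteq> M \<Longrightarrow> span_over R W \<subseteq> M"
proof
  fix x assume M: "submodule_over R M" "W \<subseteq> M" and "x \<in> span_over R W"
  from this(3) show "x \<in> M"
    by (induction rule: span_over.induct) (use M in \<open>auto simp: submodule_over_def\<close>)
qed

text \<open>Supplies the nonzero vector that an eigenvector argument requires: zero generators span
  only zero.\<close>

lemma span_over_nonzero_generator:
  assumes "x \<in> span_over R W" "x \<noteq> 0"
  obtains w where "w \<in> W" "w \<noteq> 0"
proof -
  have "\<exists>w\<in>W. w \<noteq> 0"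
  proof (rule ccontr)
    assume "\<not> (\<exists>w\<in>W. w \<noteq> 0)"
    then have "span_over R W \<subseteq> {0}" by (intro span_over_least submodule_overI) auto
    then show False using assms by blast
  qed
  then show ?thesis using that by blast
qed

lemma submodule_image_mult:
  assumes J: "submodule_over R J"
  shows "submodule_over R ((\<lambda>j. x * j) ` J)"
proof (rule submodule_overI)
  show "0 \<in> (\<lambda>j. x * j) ` J" using submodule_zero[OF J] by (auto intro!: image_eqI[of _ _ 0])
next
  fix a b assume "a \<in> (\<lambda>j. x * j) ` J" "b \<in> (\<lambda>j. x * j) ` J"
  then show "a + b \<in> (\<lambda>j. x * j) ` J" using submodule_add[OF J] by (auto simp flip: distrib_left)
next
  fix r a assume "r \<in> R" "a \<in> (\<lambda>j. x * j) ` J"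
  then show "r * a \<in> (\<lambda>j. x * j) ` J" using submodule_scale[OF J] by (auto simp: mult.left_commute)
qed

context field_subring
begin

lemma submodule_diff: "submodule_over R M \<Longrightarrow> x \<in> M \<Longrightarrow> y \<in> M \<Longrightarrow> x - y \<in> M"
  using submodule_add[of R M x "(-1) * y"] submodule_scale[of R M "-1" y] uminus_mem[OF one_mem] by simp

lemma submodule_uminus: "submodule_over R M \<Longrightarrow> x \<in> M \<Longrightarrow> - x \<in> M"
  using submodule_diff[of M 0 x] by (simp add: submodule_zero)

lemma submodule_self: "submodule_over R R"
  by (rule submodule_overI) auto

lemma span_over_add: "x \<in> span_over R W \<Longrightarrow> y \<in> span_over R W \<Longrightarrow> x + y \<in> span_over R W"
  by (induction rule: span_over.induct) (auto simp: add.assoc intro: span_over_step)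

lemma span_over_scale:
  assumes "r \<in> R" "x \<in> span_over R W"
  shows "r * x \<in> span_over R W"
  using assms(2)
proof (induction rule: span_over.induct)
  case (span_over_step s w v)
  then show ?case
    using assms(1) span_over.span_over_step[of "r * s" R w W "r * v"] by (auto simp: algebra_simps)
qed auto

lemma submodule_span_over: "submodule_over R (span_over R W)"
  by (rule submodule_overI) (auto intro: span_over_add span_over_scale)

lemma span_over_base: "w \<in> W \<Longrightarrow> w \<in> span_over R W"
  using span_over_step[of 1 R w W 0] by auto

lemma span_over_stable:
  assumes "\<And>w. w \<in> W \<Longrightarrow> x * w \<in> span_over R V" "v \<in> span_over R W"
  shows "x * v \<in> span_over R V"
  using assms(2)
proof (induction rule: span_over.induct)
  case (span_over_step r w v)
  then have "r * (x * w) + x * v \<in> span_over R V"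
    using span_over_add[OF span_over_scale[OF _ assms(1)]] by blast
  then show ?case by (simp add: algebra_simps)
qed auto

lemma span_over_mono: "W \<subseteq> V \<Longrightarrow> span_over R W \<subseteq> span_over R V"
  by (intro span_over_least submodule_span_over) (auto intro: span_over_base)

lemma span_over_coeffs:
  assumes "finite W" "x \<in> span_over R W"
  obtains c where "\<And>w. c w \<in> R" "x = (\<Sum>w\<in>W. c w * w)"
proof -
  have "\<exists>c. (\<forall>w. c w \<in> R) \<and> x = (\<Sum>w\<in>W. c w * w)"
    using assms(2)
  proof (induction rule: span_over.induct)
    case span_over_zero
    show ?case by (rule exI[of _ "\<lambda>_. 0"]) auto
  next
    case (span_over_step r w v)
    then obtain c where c: "\<And>w. c w \<in> R" "v = (\<Sum>w\<in>W. c w * w)" by blast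
    have "(\<Sum>u\<in>W. (c(w := c w + r)) u * u) = r * w + (\<Sum>u\<in>W. c u * u)"
      using assms(1) span_over_step.hyps(2) by (simp add: sum.remove[of _ w] algebra_simps)
    then show ?case
      using c span_over_step.hyps(1) by (intro exI[of _ "c(w := c w + r)"]) auto
  qed
  then show ?thesis using that by blast
qed

text \<open>The Cayley--Hamilton argument: \<open>x\<close> is an eigenvalue of the matrix by which it acts on \<open>W\<close>.\<close>

lemma monic_of_stable_span:
  assumes W: "finite W" "w\<^sub>0 \<in> W" "w\<^sub>0 \<noteq> 0"
    and x: "\<And>w. w \<in> W \<Longrightarrow> x * w \<in> span_over R W"
  obtains p where "p \<in> polys_over R" "Polynomial.lead_coeff p = 1"
    "Polynomial.degree p = card W" "poly p x = 0"
proof -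
  obtain ws where ws: "set ws = W" "distinct ws"
    using W(1) finite_distinct_list by blast
  define n where "n = length ws"
  have n: "n = card W" using ws by (simp add: n_def distinct_card[symmetric])
  have "\<forall>w\<in>W. \<exists>c. (\<forall>u. c u \<in> R) \<and> x * w = (\<Sum>u\<in>W. c u * u)"
    using x span_over_coeffs[OF W(1)] by metis
  then obtain c where c: "\<And>w u. w \<in> W \<Longrightarrow> c w u \<in> R"
    and xc: "\<And>w. w \<in> W \<Longrightarrow> x * w = (\<Sum>u\<in>W. c w u * u)" by metis
  define M where "M = mat n n (\<lambda>(i, j). c (ws ! i) (ws ! j))"
  \<comment> \<open>The generators themselves form the eigenvector. They may be linearly dependent,
    so \<open>M\<close> is just one matrix that describes the action of \<open>x\<close>.\<close>
  define v where "v = vec n (\<lambda>i. ws ! i)"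
  have M: "M \<in> carrier_mat n n" by (simp add: M_def)
  have "M *\<^sub>v v = x \<cdot>\<^sub>v v"
  proof (rule eq_vecI)
    fix i assume "i < dim_vec (x \<cdot>\<^sub>v v)"
    then have i: "i < n" by (simp add: v_def)
    have wi: "ws ! i \<in> W" using i ws by (auto simp: n_def)
    have "(M *\<^sub>v v) $ i = (\<Sum>j<n. c (ws ! i) (ws ! j) * (ws ! j))"
      using i by (simp add: M_def v_def scalar_prod_def atLeast0LessThan)
    also have "\<dots> = (\<Sum>u\<in>W. c (ws ! i) u * u)"
      unfolding n_def by (rule sum.reindex_bij_betw[OF bij_betw_nth[OF ws(2) refl ws(1)[symmetric]]])
    also have "\<dots> = x * ws ! i" using xc[OF wi] by simp
    finally show "(M *\<^sub>v v) $ i = (x \<cdot>\<^sub>v v) $ i" using i by (simp add: v_def)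
  qed (simp add: M_def v_def)
  moreover have "v \<noteq> 0\<^sub>v n"
  proof
    assume "v = 0\<^sub>v n"
    obtain i where "i < n" "ws ! i = w\<^sub>0" using W(2) ws by (auto simp: in_set_conv_nth n_def)
    then have "v $ i = w\<^sub>0" by (simp add: v_def)
    then show False using \<open>v = 0\<^sub>v n\<close> \<open>i < n\<close> W(3) by simp
  qed
  ultimately have "eigenvalue M x"
    unfolding eigenvalue_def eigenvector_def by (intro exI[of _ v]) (auto simp: M_def v_def)
  then have root: "poly (char_poly M) x = 0"
    using eigenvalue_root_char_poly[OF M] by simp
  have "char_poly_matrix M $$ (i, j) \<in> polys_over R" if "i < n" "j < n" for i j
  proof -
    have "c (ws ! i) (ws ! j) \<in> R" using c[of "ws ! i"] that ws by (auto simp: n_def)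
    then show ?thesis using that by (auto simp: char_poly_matrix_def M_def)
  qed
  \<comment> \<open>The Leibniz expansion expresses the determinant by sums, products and signs of
    entries that lie in \<open>polys_over R\<close>.\<close>
  then have "char_poly M \<in> polys_over R"
    unfolding char_poly_def det_def'[OF char_poly_matrix_closed[OF M]]
    by (intro polys_sum polys_mult polys_prod)
       (auto simp: sign_def permutes_in_image intro!: polys_uminus)
  with root degree_monic_char_poly[OF M] n show ?thesis
    by (intro that[of "char_poly M"]) auto
qed

text \<open>The set \<open>W\<close> consists of the products \<open>x ^ i * v\<close> with
  \<open>i\<close> below the degree of \<open>p\<close>; the top power is rewritten by means of
  \<open>p\<close>. The coefficients of \<open>p\<close> are only asked to map \<open>V\<close> into
  its span, which also covers coefficients integral over \<open>R\<close>. The last conclusion lets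
  stability under several elements accumulate.\<close>

lemma adjoin_stable:
  assumes V: "finite V"
    and p: "Polynomial.lead_coeff p = 1" "poly p x = 0"
    and st: "\<And>i v. v \<in> V \<Longrightarrow> Polynomial.coeff p i * v \<in> span_over R V"
  obtains W where "finite W" "V \<subseteq> W" "\<And>w. w \<in> W \<Longrightarrow> x * w \<in> span_over R W"
    "\<And>z w. (\<And>v. v \<in> V \<Longrightarrow> z * v \<in> span_over R V) \<Longrightarrow> w \<in> W \<Longrightarrow> z * w \<in> span_over R W"
proof -
  define n where "n = Polynomial.degree p"
  have n: "n > 0" unfolding n_def using p by (rule degree_pos_of_monic_root)
  define W where "W = (\<lambda>(i, v). x ^ i * v) ` ({..<n} \<times> V)"
  have W: "x ^ i * v \<in> W" if "i < n" "v \<in> V" for i v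
    unfolding W_def using that by (intro image_eqI[of _ _ "(i, v)"]) auto
  have xW: "x ^ i * v \<in> span_over R W" if "i < n" "v \<in> span_over R V" for i v
    using span_over_stable[of V "x ^ i" W v] that W span_over_base by blast
  show ?thesis
  proof (rule that[of W])
    show "finite W" using V by (simp add: W_def)
    show "V \<subseteq> W" using W[of 0] n by auto
  next
    fix w assume "w \<in> W"
    then obtain i v where iv: "i < n" "v \<in> V" "w = x ^ i * v" by (auto simp: W_def)
    show "x * w \<in> span_over R W"
    proof (cases "Suc i < n")
      case True
      then show ?thesis using W[OF True iv(2)] iv by (auto simp: algebra_simps intro: span_over_base)
    next
      case False
      then have "Suc i = n" using iv by simp
      have "0 = (\<Sum>k\<le>n. Polynomial.coeff p k * x ^ k)"
        using p(2) by (simp add: poly_altdef n_def)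
      also have "\<dots> = x ^ n + (\<Sum>k<n. Polynomial.coeff p k * x ^ k)"
        using p(1) by (simp add: lessThan_Suc_atMost[symmetric] n_def)
      finally have "x ^ n = - (\<Sum>k<n. Polynomial.coeff p k * x ^ k)"
        by (simp add: eq_neg_iff_add_eq_0)
      moreover have "x * w = x ^ n * v"
        using \<open>Suc i = n\<close> iv by auto
      ultimately have "x * w = - (\<Sum>k<n. x ^ k * (Polynomial.coeff p k * v))"
        by (simp add: sum_distrib_left mult_ac)
      moreover have "(\<Sum>k<n. x ^ k * (Polynomial.coeff p k * v)) \<in> span_over R W"
        by (rule submodule_sum[OF submodule_span_over]) (use iv in \<open>auto intro!: xW st\<close>)
      ultimately show ?thesis using submodule_uminus[OF submodule_span_over] by simp
    qed
  next
    fix z w assume z: "\<And>v. v \<in> V \<Longrightarrow> z * v \<in> span_over R V" and "w \<in> W"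
    then obtain i v where iv: "i < n" "v \<in> V" "w = x ^ i * v" by (auto simp: W_def)
    have "x ^ i * (z * v) \<in> span_over R W" using iv z by (intro xW) auto
    then show "z * w \<in> span_over R W" using iv by (simp add: mult_ac)
  qed
qed

lemma integral_of_stable:
  assumes "finite W" "w\<^sub>0 \<in> W" "w\<^sub>0 \<noteq> 0" "\<And>w. w \<in> W \<Longrightarrow> x * w \<in> span_over R W"
  shows "integral_over R x"
  using monic_of_stable_span[OF assms] unfolding integral_over_def by metis

text \<open>Adjoining first \<open>x\<close> and then \<open>y\<close> to the set containing only 1
  gives finitely many monomials on which both act. Sums and products of the two then act as well, so
  integral elements form a ring.\<close>

lemma integral_common_stable:
  assumes "integral_over R x" "integral_over R y"
  obtains W where "finite W" "1 \<in> W" "\<And>w. w \<in> W \<Longrightarrow> x * w \<in> span_over R W"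
    "\<And>w. w \<in> W \<Longrightarrow> y * w \<in> span_over R W"
proof -
  obtain p q where p: "p \<in> polys_over R" "Polynomial.lead_coeff p = 1" "poly p x = 0"
    and q: "q \<in> polys_over R" "Polynomial.lead_coeff q = 1" "poly q y = 0"
    using assms by (auto simp: integral_over_def)
  have st: "Polynomial.coeff f i * v \<in> span_over R V" if "v \<in> V" "f \<in> polys_over R" for i v V f
    using that by (intro span_over_scale span_over_base polys_overD)
  obtain V where V: "finite V" "{1} \<subseteq> V" "\<And>w. w \<in> V \<Longrightarrow> x * w \<in> span_over R V"
    using adjoin_stable[of "{1}" p x] p st[OF _ p(1)] by (metis finite.emptyI finite.insertI)
  obtain W where "finite W" "V \<subseteq> W" "\<And>w. w \<in> W \<Longrightarrow> y * w \<in> span_over R W"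
    "\<And>z w. (\<And>v. v \<in> V \<Longrightarrow> z * v \<in> span_over R V) \<Longrightarrow> w \<in> W \<Longrightarrow> z * w \<in> span_over R W"
    using adjoin_stable[OF V(1) q(2,3) st[OF _ q(1)]] by blast
  with V show ?thesis by (intro that[of W]) auto
qed

lemma integral_of_mem: "x \<in> R \<Longrightarrow> integral_over R x"
  unfolding integral_over_def by (intro bexI[of _ "[:-x, 1:]"]) auto

lemma subset_integral_closure: "R \<subseteq> integral_closure R"
  by (auto simp: integral_closure_def integral_of_mem)

lemma field_subring_integral_closure: "field_subring (integral_closure R)"
proof
  show "1 \<in> integral_closure R" using subset_integral_closure by auto
next
  fix x y assume "x \<in> integral_closure R" "y \<in> integral_closure R"
  then obtain W where W: "finite W" "1 \<in> W" "\<And>w. w \<in> W \<Longrightarrow> x * w \<in> span_over R W"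
    "\<And>w. w \<in> W \<Longrightarrow> y * w \<in> span_over R W"
    using integral_common_stable by (auto simp: integral_closure_def)
  have "(x - y) * w \<in> span_over R W" if "w \<in> W" for w
    using submodule_diff[OF submodule_span_over W(3)[OF that] W(4)[OF that]] by (simp add: algebra_simps)
  then show "x - y \<in> integral_closure R"
    unfolding integral_closure_def using integral_of_stable[OF W(1,2)] by auto
  have "x * y * w \<in> span_over R W" if "w \<in> W" for w
    using span_over_stable[OF W(3) W(4)[OF that]] by (simp add: algebra_simps)
  then show "x * y \<in> integral_closure R"
    unfolding integral_closure_def using integral_of_stable[OF W(1,2)] by auto
qed

end

section \<open>Primitive elements\<close>

text \<open>For a field \<open>K\<close> and an element algebraic over it this ring is already the
  field generated by the element. Primitivity of \<open>x\<close> is therefore expressed as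
  \<open>adjoin K x = UNIV\<close>.\<close>

definition adjoin :: "'a::field set \<Rightarrow> 'a \<Rightarrow> 'a set" where
  "adjoin R x = {poly p x | p. p \<in> polys_over R}"

locale field_subfield = field_subring K for K :: "'a::field set" +
  assumes inverse_mem [intro]: "x \<in> K \<Longrightarrow> inverse x \<in> K"
begin

lemma divide_mem [intro]: "x \<in> K \<Longrightarrow> y \<in> K \<Longrightarrow> x / y \<in> K"
  by (auto simp: divide_inverse)

lemma minimal_poly_exists:
  assumes "p \<in> polys_over K" "p \<noteq> 0" "poly p x = 0"
  obtains m where "is_minimal_poly K x m"
proof -
  obtain q where q: "q \<in> polys_over K \<and> q \<noteq> 0 \<and> poly q x = 0"
    and min: "\<And>r. r \<in> polys_over K \<and> r \<noteq> 0 \<and> poly r x = 0 \<Longrightarrow> Polynomial.degree q \<le> Polynomial.degree r"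
    using exists_least_iff[of "\<lambda>n. \<exists>q. q \<in> polys_over K \<and> q \<noteq> 0 \<and> poly q x = 0 \<and> Polynomial.degree q = n"] assms
    by (metis not_less)
  define m where "m = Polynomial.smult (inverse (Polynomial.lead_coeff q)) q"
  have "is_minimal_poly K x m"
    unfolding is_minimal_poly_def using q min
    by (auto simp: m_def intro!: polys_smult polys_overD)
  then show ?thesis by (rule that)
qed

lemma minimal_poly_dvd:
  assumes "is_minimal_poly K x m" "q \<in> polys_over K" "poly q x = 0"
  obtains s where "s \<in> polys_over K" "q = s * m"
proof -
  have m: "m \<in> polys_over K" "Polynomial.lead_coeff m = 1" "poly m x = 0"
    using assms by (auto simp: is_minimal_poly_def)
  obtain s r where sr: "s \<in> polys_over K" "r \<in> polys_over K" "q = s * m + r"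
    "\<And>i. i \<ge> Polynomial.degree m \<Longrightarrow> Polynomial.coeff r i = 0"
    using monic_division[OF m(1,2) assms(2)] by blast
  have "poly r x = 0" using sr(3) assms(3) m(3) by simp
  have "r = 0"
  proof (rule ccontr)
    assume "r \<noteq> 0"
    then have "Polynomial.degree m \<le> Polynomial.degree r"
      using assms(1) sr(2) \<open>poly r x = 0\<close> by (auto simp: is_minimal_poly_def)
    then have "Polynomial.lead_coeff r = 0" using sr(4) by blast
    then show False using \<open>r \<noteq> 0\<close> by simp
  qed
  then show ?thesis using that sr by simp
qed

end

context field_subring
begin

lemma adjoin_base: "R \<subseteq> adjoin R x"
proof
  fix a assume "a \<in> R"
  then show "a \<in> adjoin R x" unfolding adjoin_def by (auto intro!: exI[of _ "[:a:]"])
qed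

lemma adjoin_gen: "x \<in> adjoin R x"
  unfolding adjoin_def by (auto intro!: exI[of _ "[:0, 1:]"])

lemma field_subring_adjoin: "field_subring (adjoin R x)"
proof
  show "1 \<in> adjoin R x" using adjoin_base by auto
next
  fix a b assume "a \<in> adjoin R x" "b \<in> adjoin R x"
  then obtain p q where "p \<in> polys_over R" "q \<in> polys_over R" "a = poly p x" "b = poly q x"
    by (auto simp: adjoin_def)
  then show "a - b \<in> adjoin R x" "a * b \<in> adjoin R x"
    unfolding adjoin_def by (force intro: exI[of _ "p - q"], force intro: exI[of _ "p * q"])
qed

lemma adjoin_least:
  assumes "field_subring S" "R \<subseteq> S" "x \<in> S"
  shows "adjoin R x \<subseteq> S"
proof -
  interpret S: field_subring S by fact
  show ?thesis using polys_over_mono[OF assms(2)] assms(3) by (auto simp: adjoin_def)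
qed

end

context field_subfield
begin

text \<open>Write the minimal polynomial of a nonzero \<open>y\<close> as \<open>a + X q\<close>.
  Minimality forces \<open>a\<close> to be nonzero, and \<open>y q(y) = - a\<close> exhibits the
  inverse of \<open>y\<close> as a polynomial expression.\<close>

lemma field_subfield_adjoin:
  assumes alg: "\<And>y. \<exists>m. is_minimal_poly K y m"
  shows "field_subfield (adjoin K x)"
proof -
  interpret S: field_subring "adjoin K x" by (rule field_subring_adjoin)
  show ?thesis
  proof
    fix y assume y: "y \<in> adjoin K x"
    show "inverse y \<in> adjoin K x"
    proof (cases "y = 0")
      case False
      obtain m where m: "is_minimal_poly K y m" using alg by blast
      obtain a q where aq: "m = pCons a q" by (cases m)
      have mK: "m \<in> polys_over K" "Polynomial.lead_coeff m = 1" "poly m y = 0"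
        using m by (auto simp: is_minimal_poly_def)
      then have aK: "a \<in> K" "q \<in> polys_over K" by (auto simp: aq polys_pCons_iff)
      have "a \<noteq> 0"
      proof
        assume "a = 0"
        then have "poly q y = 0" "q \<noteq> 0" using mK False by (auto simp: aq)
        then have "Polynomial.degree m \<le> Polynomial.degree q"
          using m aK by (auto simp: is_minimal_poly_def)
        then show False using \<open>q \<noteq> 0\<close> by (simp add: aq)
      qed
      have "y * poly q y = - a" using mK(3) by (simp add: aq eq_neg_iff_add_eq_0 add.commute)
      then have "inverse y = - (inverse a * poly q y)"
        using \<open>a \<noteq> 0\<close> False by (simp add: field_simps)
      moreover have "poly q y \<in> adjoin K x"
        using polys_over_mono[OF adjoin_base] aK y by (intro S.poly_mem) auto
      moreover have "inverse a \<in> adjoin K x" using adjoin_base aK by auto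
      ultimately show ?thesis by auto
    qed auto
  qed
qed

end

section \<open>Polynomials carried over to the algebraic closure\<close>

lemma map_poly_to_ac_add: "map_poly to_ac (p + q) = map_poly to_ac p + map_poly to_ac q"
  by (rule poly_eqI) (simp add: coeff_map_poly)

lemma map_poly_to_ac_mult: "map_poly to_ac (p * q) = map_poly to_ac p * map_poly to_ac q"
  by (rule poly_eqI) (simp add: coeff_map_poly coeff_mult to_ac_sum)

lemma map_poly_to_ac_pCons [simp]: "map_poly to_ac (pCons a p) = pCons (to_ac a) (map_poly to_ac p)"
  by (rule poly_eqI) (simp add: coeff_map_poly coeff_pCons split: nat.split)

lemma map_poly_to_ac_pcompose:
  "map_poly to_ac (pcompose p q) = pcompose (map_poly to_ac p) (map_poly to_ac q)"
  by (induction p) (simp_all add: pcompose_pCons map_poly_to_ac_add map_poly_to_ac_mult)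

lemma map_poly_to_ac_pderiv: "map_poly to_ac (pderiv p) = pderiv (map_poly to_ac p)"
  by (rule poly_eqI) (simp add: coeff_map_poly coeff_pderiv)

lemma poly_map_poly_to_ac: "poly (map_poly to_ac p) (to_ac x) = to_ac (poly p x)"
  by (induction p) simp_all

lemma degree_map_poly_to_ac [simp]: "Polynomial.degree (map_poly to_ac p) = Polynomial.degree p"
  by (rule degree_map_poly) simp

lemma map_poly_to_ac_eq_0_iff [simp]: "map_poly to_ac p = 0 \<longleftrightarrow> p = 0"
  by (simp add: map_poly_eq_0_iff)

context field_subfield
begin

text \<open>
  Outside the bad set \<open>T\<close>, the minimal polynomial of \<open>\<alpha>\<close> over \<open>K(\<beta> + t \<alpha>)\<close> divides both \<open>f(X)\<close> and
  \<open>g(\<beta> + t \<alpha> - t X)\<close>, whose only common root is \<open>\<alpha>\<close>.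
\<close>

lemma primitive_element_pair:
  assumes alg: "\<And>y. \<exists>m. is_minimal_poly K y m"
    and sep: "separable_element K \<alpha>"
  obtains T where "finite T"
    "\<And>t. t \<in> K \<Longrightarrow> t \<notin> T \<Longrightarrow> \<alpha> \<in> adjoin K (\<beta> + t * \<alpha>) \<and> \<beta> \<in> adjoin K (\<beta> + t * \<alpha>)"
proof -
  obtain f where f: "is_minimal_poly K \<alpha> f" and sqf: "rsquarefree (map_poly to_ac f)"
    using sep by (auto simp: separable_element_def)
  obtain g where g: "is_minimal_poly K \<beta> g" using alg by blast
  have fK: "f \<in> polys_over K" "Polynomial.lead_coeff f = 1" "poly f \<alpha> = 0"
    and gK: "g \<in> polys_over K" "Polynomial.lead_coeff g = 1" "poly g \<beta> = 0"
    using f g by (auto simp: is_minimal_poly_def)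
  have f0: "f \<noteq> 0" "g \<noteq> 0" using fK gK by auto
  define Zf where "Zf = {z. poly (map_poly to_ac f) z = 0}"
  define Zg where "Zg = {z. poly (map_poly to_ac g) z = 0}"
  have fin: "finite Zf" "finite Zg"
    unfolding Zf_def Zg_def using f0 by (intro poly_roots_finite; simp)+
  \<comment> \<open>If \<gamma> - t z is a root \<open>w\<close> of \<open>g\<close> for a root
    \<open>z\<close> of \<open>f\<close> other than \<alpha>, then \<open>t\<close> is the quotient
    displayed here. Pairs with \<open>z\<close> equal to \<alpha> divide by zero and add only the
    value 0 to \<open>T\<close>.\<close>
  define T where "T = to_ac -` ((\<lambda>(w, z). (w - to_ac \<beta>) / (to_ac \<alpha> - z)) ` (Zg \<times> Zf))"
  have "finite T"
    unfolding T_def using fin inj_to_ac by (intro finite_vimageI) auto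
  moreover have "\<alpha> \<in> adjoin K (\<beta> + t * \<alpha>) \<and> \<beta> \<in> adjoin K (\<beta> + t * \<alpha>)" if t: "t \<in> K" "t \<notin> T" for t
  proof -
    define \<gamma> where "\<gamma> = \<beta> + t * \<alpha>"
    interpret F: field_subfield "adjoin K \<gamma>" by (rule field_subfield_adjoin[OF alg])
    have fF: "f \<in> polys_over (adjoin K \<gamma>)" and gF: "g \<in> polys_over (adjoin K \<gamma>)"
      using fK gK polys_over_mono[OF adjoin_base] by auto
    have tF: "t \<in> adjoin K \<gamma>" using t adjoin_base by auto
    have \<gamma>F: "\<gamma> \<in> adjoin K \<gamma>" by (rule adjoin_gen)
    obtain m where m: "is_minimal_poly (adjoin K \<gamma>) \<alpha> m"
      using F.minimal_poly_exists[OF fF f0(1) fK(3)] by blast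
    have mF: "m \<in> polys_over (adjoin K \<gamma>)" "Polynomial.lead_coeff m = 1" "poly m \<alpha> = 0"
      using m by (auto simp: is_minimal_poly_def)
    define h where "h = pcompose g [:\<gamma>, -t:]"
    have hF: "h \<in> polys_over (adjoin K \<gamma>)"
      unfolding h_def using gF tF \<gamma>F by (intro F.polys_pcompose F.polys_pCons) auto
    have h\<alpha>: "poly h \<alpha> = 0" by (simp add: h_def poly_pcompose \<gamma>_def gK(3) algebra_simps)
    obtain s1 where s1: "f = s1 * m" using F.minimal_poly_dvd[OF m fF fK(3)] by blast
    obtain s2 where s2: "h = s2 * m" using F.minimal_poly_dvd[OF m hF h\<alpha>] by blast
    have only: "z = to_ac \<alpha>" if z: "poly (map_poly to_ac m) z = 0" for z
    proof (rule ccontr)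
      assume ne: "z \<noteq> to_ac \<alpha>"
      have "poly (map_poly to_ac f) z = 0" "poly (map_poly to_ac h) z = 0"
        using z by (simp_all add: s1 s2 map_poly_to_ac_mult)
      then have "z \<in> Zf" and w: "to_ac \<gamma> - to_ac t * z \<in> Zg"
        by (simp_all add: Zf_def Zg_def h_def map_poly_to_ac_pcompose poly_pcompose algebra_simps)
      moreover have "to_ac t = ((to_ac \<gamma> - to_ac t * z) - to_ac \<beta>) / (to_ac \<alpha> - z)"
        using ne by (simp add: \<gamma>_def field_simps)
      ultimately have "t \<in> T" unfolding T_def by force
      with t show False by simp
    qed
    define M where "M = map_poly to_ac m"
    have "poly M (to_ac \<alpha>) = 0" by (simp add: M_def poly_map_poly_to_ac mF(3))
    then obtain N where N: "M = [:- to_ac \<alpha>, 1:] * N" by (auto simp: poly_eq_0_iff_dvd dvd_def)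
    have "m \<noteq> 0" using mF by auto
    then have N0: "N \<noteq> 0" using N by (auto simp: M_def)
    \<comment> \<open>A nonconstant \<open>N\<close> would have a root, which could only be
      \<alpha>. Then \<alpha> would be a double root of \<open>f\<close>, against separability. So
      \<open>m\<close> is linear and its constant coefficient is - \<alpha>.\<close>
    have "Polynomial.degree N = 0"
    proof (rule ccontr)
      assume "Polynomial.degree N \<noteq> 0"
      then obtain z where z: "poly N z = 0" using alg_closed_imp_poly_has_root[of N] by blast
      then have "poly M z = 0" by (simp add: N)
      then have "z = to_ac \<alpha>" using only by (simp add: M_def)
      with z have "[:- to_ac \<alpha>, 1:] dvd N" by (simp add: poly_eq_0_iff_dvd)
      then have "[:- to_ac \<alpha>, 1:] ^ 2 dvd M" unfolding N power2_eq_square by (rule mult_dvd_mono[OF dvd_refl])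
      also have "M dvd map_poly to_ac f" by (simp add: s1 map_poly_to_ac_mult M_def)
      finally have "2 \<le> order (to_ac \<alpha>) (map_poly to_ac f)"
        using f0 by (intro order_max) auto
      then show False using sqf unfolding rsquarefree_def by (metis not_numeral_le_zero numeral_le_one_iff semiring_norm(69))
    qed
    then have "Polynomial.degree M = 1" unfolding N using N0 by (subst degree_mult_eq) auto
    then have "Polynomial.degree m = 1" by (simp add: M_def)
    then have "m = [:Polynomial.coeff m 0, 1:]"
      using mF(2) by (intro poly_eqI) (auto simp: coeff_pCons coeff_eq_0 split: nat.split)
    then have "\<alpha> = - Polynomial.coeff m 0" using mF(3)
      by (metis add.inverse_inverse add_eq_0_iff mult.right_neutral mult_zero_right poly_0 poly_pCons add_0_right)
    then have \<alpha>F: "\<alpha> \<in> adjoin K \<gamma>" using polys_overD[OF mF(1), of 0] by auto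
    have "\<gamma> - t * \<alpha> \<in> adjoin K \<gamma>" using \<gamma>F tF \<alpha>F by blast
    then show ?thesis using \<alpha>F by (simp add: \<gamma>_def)
  qed
  ultimately show ?thesis by (rule that)
qed

text \<open>Elements are absorbed one at a time: each step excludes finitely many parameters, and an
  infinite \<open>K\<close> leaves one to choose.\<close>

lemma primitive_element_finite_set:
  assumes inf: "infinite K" and sep: "\<And>y. separable_element K y" and "finite S"
  obtains \<gamma> where "S \<subseteq> adjoin K \<gamma>"
proof -
  have alg: "\<exists>m. is_minimal_poly K y m" for y
    using sep[of y] by (auto simp: separable_element_def)
  from \<open>finite S\<close> have "\<exists>\<gamma>. S \<subseteq> adjoin K \<gamma>"
  proof (induction S rule: finite_induct)
    case (insert \<alpha> S)
    then obtain \<beta> where \<beta>: "S \<subseteq> adjoin K \<beta>" by blast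
    obtain T where T: "finite T"
      "\<And>t. t \<in> K \<Longrightarrow> t \<notin> T \<Longrightarrow> \<alpha> \<in> adjoin K (\<beta> + t * \<alpha>) \<and> \<beta> \<in> adjoin K (\<beta> + t * \<alpha>)"
      using primitive_element_pair[OF alg sep] by blast
    obtain t where "t \<in> K" "t \<notin> T" using inf T(1) by (meson finite_subset subsetI)
    then have "\<alpha> \<in> adjoin K (\<beta> + t * \<alpha>)" "\<beta> \<in> adjoin K (\<beta> + t * \<alpha>)" using T by auto
    then show ?case
      using \<beta> adjoin_least[OF field_subring_adjoin adjoin_base, of \<beta> "\<beta> + t * \<alpha>"] by blast
  qed auto
  then show ?thesis using that by blast
qed

end

section \<open>Finiteness of the integral closure\<close>

context field_subring
begin

lemma span_over_insert:
  assumes "x \<in> span_over R (insert w W)"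
  obtains r v where "r \<in> R" "v \<in> span_over R W" "x = r * w + v"
proof -
  have "\<exists>r\<in>R. \<exists>v\<in>span_over R W. x = r * w + v"
    using assms
  proof (induction rule: span_over.induct)
    case span_over_zero
    show ?case by (intro bexI[of _ 0]) auto
  next
    case (span_over_step s u x)
    then obtain r v where rv: "r \<in> R" "v \<in> span_over R W" "x = r * w + v" by blast
    show ?case
    proof (cases "u = w")
      case True
      then show ?thesis using rv span_over_step.hyps
        by (intro bexI[of _ "s + r"] bexI[of _ v]) (auto simp: algebra_simps)
    next
      case False
      then have "s * u + v \<in> span_over R W" using span_over_step.hyps rv by (auto intro: span_over.span_over_step)
      then show ?thesis using rv
        by (intro bexI[of _ r] bexI[of _ "s * u + v"]) (auto simp: algebra_simps)
    qed
  qed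
  then show ?thesis using that by blast
qed

text \<open>Induction on the generators of the surrounding module. The coefficients that elements of
  \<open>N\<close> can have at a new generator \<open>w\<close>, modulo the span of
  \<open>W\<close>, form an ideal \<open>I\<close>. Elements of \<open>N\<close> lifting generators
  of \<open>I\<close>, together with generators of \<open>N \<inter> span_over R W\<close>, generate
  \<open>N\<close>.\<close>

lemma submodule_finitely_generated:
  assumes noeth: "\<And>I. submodule_over R I \<Longrightarrow> I \<subseteq> R \<Longrightarrow> \<exists>S. finite S \<and> I = span_over R S"
    and "finite W" "submodule_over R N" "N \<subseteq> span_over R W"
  shows "\<exists>S. finite S \<and> N = span_over R S"
  using assms(2-)
proof (induction W arbitrary: N rule: finite_induct)
  case empty
  have "x = 0" if "x \<in> span_over R {}" for x using that by (induction rule: span_over.induct) auto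
  then have "span_over R {} \<subseteq> {0}" by blast
  then have "N = span_over R {}" using empty.prems submodule_zero by blast
  then show ?case by blast
next
  case (insert w W)
  note span = submodule_span_over[of W]
  define I where "I = {a \<in> R. \<exists>x\<in>N. x - a * w \<in> span_over R W}"
  have "submodule_over R I"
  proof (rule submodule_overI)
    show "0 \<in> I" using insert.prems by (auto simp: I_def submodule_zero intro!: bexI[of _ 0])
  next
    fix a b assume "a \<in> I" "b \<in> I"
    then obtain x y where "x \<in> N" "y \<in> N" "x - a * w \<in> span_over R W" "y - b * w \<in> span_over R W" "a \<in> R" "b \<in> R"
      by (auto simp: I_def)
    moreover from this have "(x + y) - (a + b) * w \<in> span_over R W"
      using span_over_add[of "x - a * w" W "y - b * w"] by (simp add: algebra_simps)
    ultimately show "a + b \<in> I"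
      using submodule_add[OF insert.prems(1)] by (auto simp: I_def intro!: bexI[of _ "x + y"])
  next
    fix r a assume "r \<in> R" "a \<in> I"
    then obtain x where "x \<in> N" "x - a * w \<in> span_over R W" "a \<in> R" by (auto simp: I_def)
    moreover from this \<open>r \<in> R\<close> have "r * x - r * a * w \<in> span_over R W"
      using span_over_scale[of r "x - a * w" W] by (simp add: algebra_simps)
    ultimately show "r * a \<in> I"
      using submodule_scale[OF insert.prems(1)] \<open>r \<in> R\<close> by (auto simp: I_def intro!: bexI[of _ "r * x"])
  qed
  then obtain S where S: "finite S" "I = span_over R S" using noeth[of I] by (auto simp: I_def)
  have "\<forall>a\<in>S. \<exists>x\<in>N. x - a * w \<in> span_over R W"
    using span_over_base[of _ S] S(2) by (auto simp: I_def)
  then obtain x where x: "\<And>a. a \<in> S \<Longrightarrow> x a \<in> N" "\<And>a. a \<in> S \<Longrightarrow> x a - a * w \<in> span_over R W" by metis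
  have "submodule_over R (N \<inter> span_over R W)" using insert.prems(1) span by (auto simp: submodule_over_def)
  then obtain S' where S': "finite S'" "N \<inter> span_over R W = span_over R S'" using insert.IH by blast
  have lift: "\<exists>u\<in>span_over R (x ` S). u - a * w \<in> span_over R W" if "a \<in> span_over R S" for a
    using that
  proof (induction rule: span_over.induct)
    case span_over_zero
    show ?case by (auto intro!: bexI[of _ 0])
  next
    case (span_over_step r s a)
    then obtain u where u: "u \<in> span_over R (x ` S)" "u - a * w \<in> span_over R W" by blast
    have "r * (x s - s * w) + (u - a * w) \<in> span_over R W"
      using span_over_step.hyps x u by (intro span_over_add span_over_scale) auto
    then have "(r * x s + u) - (r * s + a) * w \<in> span_over R W" by (simp add: algebra_simps)
    moreover have "r * x s + u \<in> span_over R (x ` S)"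
      using u span_over_step.hyps by (intro span_over.span_over_step) auto
    ultimately show ?case by blast
  qed
  have "N = span_over R (S' \<union> x ` S)"
  proof
    show "span_over R (S' \<union> x ` S) \<subseteq> N"
      using S'(2) span_over_base[of _ S'] x insert.prems(1) by (intro span_over_least) auto
    show "N \<subseteq> span_over R (S' \<union> x ` S)"
    proof
      fix n assume n: "n \<in> N"
      then obtain a v where av: "a \<in> R" "v \<in> span_over R W" "n = a * w + v"
        using insert.prems(2) span_over_insert by blast
      then have "a \<in> I" using n by (auto simp: I_def intro!: bexI[of _ n])
      then obtain u where u: "u \<in> span_over R (x ` S)" "u - a * w \<in> span_over R W" using S lift by blast
      have "u \<in> N" using u(1) span_over_least[OF insert.prems(1), of "x ` S"] x(1) by blast
      then have "n - u \<in> N" using n insert.prems(1) by (intro submodule_diff)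
      moreover have "n - u \<in> span_over R W"
        using submodule_diff[OF span av(2) u(2)] by (simp add: av(3) algebra_simps)
      ultimately have "n - u \<in> span_over R S'" using S' by blast
      then have "n - u \<in> span_over R (S' \<union> x ` S)" "u \<in> span_over R (S' \<union> x ` S)"
        using u span_over_mono[of S' "S' \<union> x ` S"] span_over_mono[of "x ` S" "S' \<union> x ` S"] by auto
      then have "(n - u) + u \<in> span_over R (S' \<union> x ` S)" by (rule span_over_add)
      then show "n \<in> span_over R (S' \<union> x ` S)" by simp
    qed
  qed
  moreover have "finite (S' \<union> x ` S)" using S(1) S'(1) by simp
  ultimately show ?case by blast
qed

section \<open>The field of fractions\<close>

lemma subset_fractions: "R \<subseteq> fractions R"
proof
  fix x assume "x \<in> R"
  then have "x = x / 1 \<and> x \<in> R \<and> 1 \<in> R \<and> (1::'a) \<noteq> 0" by simp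
  then show "x \<in> fractions R" unfolding fractions_def by blast
qed

lemma field_subfield_fractions: "field_subfield (fractions R)"
proof
  show "1 \<in> fractions R" using subset_fractions by blast
next
  fix x y assume "x \<in> fractions R" "y \<in> fractions R"
  then obtain a b c d where x: "x = a / b" "a \<in> R" "b \<in> R" "b \<noteq> 0"
    and y: "y = c / d" "c \<in> R" "d \<in> R" "d \<noteq> 0" by (auto simp: fractions_def)
  have "x - y = (a * d - c * b) / (b * d)" "x * y = (a * c) / (b * d)" using x y by (auto simp: field_simps)
  moreover have "a * d - c * b \<in> R" "b * d \<in> R" "b * d \<noteq> 0" "a * c \<in> R" using x y by auto
  ultimately show "x - y \<in> fractions R" "x * y \<in> fractions R" unfolding fractions_def by blast+
next
  fix x assume "x \<in> fractions R"
  then obtain a b where x: "x = a / b" "a \<in> R" "b \<in> R" "b \<noteq> 0" by (auto simp: fractions_def)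
  show "inverse x \<in> fractions R"
  proof (cases "a = 0")
    case True
    then show ?thesis using x subset_fractions by auto
  next
    case False
    then show ?thesis unfolding fractions_def using x by auto
  qed
qed

end

text \<open>Over an algebraically closed field the linear factors form a multiset of roots; without
  repeated roots it is a set.\<close>

lemma alg_closed_rsquarefree_decompose:
  fixes F :: "'a::alg_closed_field poly"
  assumes "rsquarefree F" "Polynomial.lead_coeff F = 1"
  shows "F = (\<Prod>z\<in>{z. poly F z = 0}. [:-z, 1:])"
proof -
  have F0: "F \<noteq> 0" using assms by auto
  obtain M where M: "F = (\<Prod>x\<in>#M. [:-x, 1:])"
    using alg_closed_imp_factorization[OF F0] assms(2) by auto
  have "count M x \<le> 1" for x
  proof (rule ccontr)
    assume "\<not> count M x \<le> 1"
    then have "{#x, x#} \<subseteq># M" by (intro mset_subset_eqI) auto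
    then obtain N where "M = {#x, x#} + N" by (auto simp: mset_subset_eq_exists_conv)
    then have "[:-x, 1:] ^ 2 dvd F" unfolding M power2_eq_square by (auto simp del: mult_pCons_left simp flip: mult.assoc)
    then have "2 \<le> order x F" using F0 by (intro order_max) auto
    then show False
      using assms(1) unfolding rsquarefree_def by (metis not_numeral_le_zero numeral_le_one_iff semiring_norm(69))
  qed
  then have "M = mset_set (set_mset M)"
    by (metis count_eq_zero_iff count_mset_set(1,3) finite_set_mset le_less_Suc_eq less_one
        linorder_not_less multiset_eqI nat_less_le Suc_eq_plus1_left add_0_right not_in_iff One_nat_def)
  then have "F = (\<Prod>x\<in>set_mset M. [:-x, 1:])" unfolding M by (metis prod_unfold_prod_mset)
  moreover from this have "{z. poly F z = 0} = set_mset M"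
    by (auto simp: poly_prod prod_zero_iff)
  ultimately show ?thesis by simp
qed

text \<open>At \<open>z\<close> only that term of the product rule survives in which the factor
  \<open>X - z\<close> is differentiated.\<close>

lemma poly_pderiv_prod_linear:
  fixes Z :: "'a::field set"
  assumes "finite Z" "z \<in> Z"
  shows "poly (pderiv (\<Prod>w\<in>Z. [:-w, 1:])) z = (\<Prod>w\<in>Z - {z}. z - w)"
proof -
  have "(\<Prod>w\<in>Z. [:-w, 1:]) = [:-z, 1:] * (\<Prod>w\<in>Z - {z}. [:-w, 1:])"
    using assms by (rule prod.remove)
  then show ?thesis by (simp add: pderiv_mult pderiv_pCons poly_prod del: mult_pCons_left)
qed

context field_subring
begin

lemma field_subring_to_ac: "field_subring (to_ac ` R)"
proof
  show "1 \<in> to_ac ` R" by (rule image_eqI[of _ _ 1]) auto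
next
  fix x y assume "x \<in> to_ac ` R" "y \<in> to_ac ` R"
  then show "x - y \<in> to_ac ` R" "x * y \<in> to_ac ` R"
    by (auto simp flip: to_ac_diff to_ac_mult)
qed

text \<open>Conjugates live in the algebraic closure, so integrality is shown there over the copy of
  \<open>R\<close>. A monic equation over this copy pulls back because \<open>to_ac\<close> is
  injective.\<close>

lemma integral_over_to_acD:
  assumes "integral_over (to_ac ` R) (to_ac x)"
  shows "integral_over R x"
proof -
  obtain p where p: "p \<in> polys_over (to_ac ` R)" "Polynomial.lead_coeff p = 1" "poly p (to_ac x) = 0"
    using assms by (auto simp: integral_over_def)
  define q where "q = map_poly of_ac p"
  have c: "Polynomial.coeff p i \<in> to_ac ` R" for i using p(1) by (rule polys_overD)
  have pq: "p = map_poly to_ac q"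
  proof (rule poly_eqI)
    fix i
    obtain r where "Polynomial.coeff p i = to_ac r" using c by blast
    then show "Polynomial.coeff p i = Polynomial.coeff (map_poly to_ac q) i" by (simp add: q_def coeff_map_poly)
  qed
  have "q \<in> polys_over R"
  proof -
    have "Polynomial.coeff q i \<in> R" for i
      using c[of i] by (auto simp: q_def coeff_map_poly)
    then show ?thesis by (simp add: polys_over_def)
  qed
  moreover have "poly q x = 0" using p(3) by (simp add: pq poly_map_poly_to_ac)
  moreover have "Polynomial.lead_coeff q = 1"
    using p(2) by (simp add: pq coeff_map_poly)
  ultimately show ?thesis unfolding integral_over_def by blast
qed

end

section \<open>Integrally closed rings and conjugates\<close>

locale integrally_closed_subring = field_subring A for A :: "'a::field set" +
  assumes int_closed: "x \<in> fractions A \<Longrightarrow> integral_over A x \<Longrightarrow> x \<in> A"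
begin

text \<open>If the monic \<open>q\<close> over \<open>A\<close> annihilates
  \<open>h(\<alpha>)\<close>, then \<open>q(h(X))\<close> vanishes at \<alpha>, is a multiple of
  \<open>f\<close>, and so vanishes at every other root of \<open>f\<close>. With \<open>h\<close>
  equal to \<open>X\<close> this gives the integrality of the roots themselves.\<close>

lemma conjugate_integral:
  assumes f: "is_minimal_poly (fractions A) \<alpha> f" and z: "poly (map_poly to_ac f) z = 0"
    and h: "h \<in> polys_over (fractions A)" "integral_over A (poly h \<alpha>)"
  shows "integral_over (to_ac ` A) (poly (map_poly to_ac h) z)"
proof -
  interpret K: field_subfield "fractions A" by (rule field_subfield_fractions)
  obtain q where q: "q \<in> polys_over A" "Polynomial.lead_coeff q = 1" "poly q (poly h \<alpha>) = 0"
    using h by (auto simp: integral_over_def)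
  have "pcompose q h \<in> polys_over (fractions A)"
    using q(1) h(1) polys_over_mono[OF subset_fractions] by blast
  moreover have "poly (pcompose q h) \<alpha> = 0" using q(3) by (simp add: poly_pcompose)
  ultimately obtain s where "pcompose q h = s * f"
    using K.minimal_poly_dvd[OF f] by blast
  then have "pcompose (map_poly to_ac q) (map_poly to_ac h) = map_poly to_ac s * map_poly to_ac f"
    by (simp flip: map_poly_to_ac_pcompose map_poly_to_ac_mult)
  then have "poly (map_poly to_ac q) (poly (map_poly to_ac h) z) = 0"
    using z by (simp flip: poly_pcompose)
  moreover have "map_poly to_ac q \<in> polys_over (to_ac ` A)"
    using q(1) by (auto simp: polys_over_def coeff_map_poly)
  moreover have "Polynomial.lead_coeff (map_poly to_ac q) = 1"
    using q(2) by (simp add: coeff_map_poly)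
  ultimately show ?thesis unfolding integral_over_def by blast
qed

text \<open>
  The remainder of \<open>h f'\<close> modulo \<open>f\<close> is, by Lagrange interpolation at the roots \<open>z\<close> of \<open>f\<close>, the sum
  of the \<open>h(z) f / (X - z)\<close>. Hence its coefficients are integral over \<open>A\<close>, and they lie in \<open>K\<close>.
\<close>

lemma deriv_mult_integral:
  assumes f: "is_minimal_poly (fractions A) \<alpha> f" and sqf: "rsquarefree (map_poly to_ac f)"
    and \<alpha>: "integral_over A \<alpha>" and y: "integral_over A y" "y \<in> adjoin (fractions A) \<alpha>"
  shows "poly (pderiv f) \<alpha> * y \<in> span_over A ((\<lambda>i. \<alpha> ^ i) ` {..<Polynomial.degree f})"
proof -
  interpret K: field_subfield "fractions A" by (rule field_subfield_fractions)
  interpret A': field_subring "to_ac ` A" by (rule field_subring_to_ac)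
  interpret I: field_subring "integral_closure (to_ac ` A)" by (rule A'.field_subring_integral_closure)
  obtain h where h: "h \<in> polys_over (fractions A)" "y = poly h \<alpha>" using y(2) by (auto simp: adjoin_def)
  define F H n where "F = map_poly to_ac f" and "H = map_poly to_ac h" and "n = Polynomial.degree f"
  define Z where "Z = {z. poly F z = 0}"
  have fK: "f \<in> polys_over (fractions A)" "Polynomial.lead_coeff f = 1" "poly f \<alpha> = 0"
    using f by (auto simp: is_minimal_poly_def)
  have F1: "Polynomial.lead_coeff F = 1" using fK by (simp add: F_def coeff_map_poly)
  have Fdec: "F = (\<Prod>z\<in>Z. [:-z, 1:])"
    using alg_closed_rsquarefree_decompose[of F] sqf F1 by (simp add: F_def Z_def)
  have finZ: "finite Z" unfolding Z_def using F1 by (intro poly_roots_finite) auto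
  have cardZ: "card Z = n"
  proof -
    have "Polynomial.degree F = card Z" unfolding Fdec by (subst degree_prod_eq_sum_degree) auto
    then show ?thesis by (simp add: F_def n_def)
  qed
  have HI: "poly H z \<in> integral_closure (to_ac ` A)" if "z \<in> Z" for z
    using conjugate_integral[OF f _ h(1)] that y(1) h(2) by (auto simp: integral_closure_def H_def Z_def F_def)
  have ZI: "z \<in> integral_closure (to_ac ` A)" if "z \<in> Z" for z
    using conjugate_integral[OF f, of z "[:0, 1:]"] that \<alpha> by (auto simp: integral_closure_def Z_def F_def)
  have "h * pderiv f \<in> polys_over (fractions A)" using h fK by auto
  then obtain q g where g: "q \<in> polys_over (fractions A)" "g \<in> polys_over (fractions A)"
    "h * pderiv f = q * f + g" "\<And>i. i \<ge> n \<Longrightarrow> Polynomial.coeff g i = 0"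
    using K.monic_division[OF fK(1,2)] unfolding n_def by blast
  define G where "G = (\<Sum>z\<in>Z. Polynomial.smult (poly H z) (\<Prod>w\<in>Z - {z}. [:-w, 1:]))"
  have GI: "G \<in> polys_over (integral_closure (to_ac ` A))"
    unfolding G_def using HI ZI by (intro I.polys_sum I.polys_smult I.polys_prod) auto
  have Gn: "Polynomial.coeff G i = 0" if "i \<ge> n" for i
  proof -
    have "Polynomial.coeff (\<Prod>w\<in>Z - {z}. [:-w, 1:]) i = 0" if "z \<in> Z" for z
    proof (rule coeff_eq_0)
      have "Polynomial.degree (\<Prod>w\<in>Z - {z}. [:-w, 1:]) = card (Z - {z})"
        by (subst degree_prod_eq_sum_degree) auto
      also have "\<dots> < card Z" using finZ that by (rule card_Diff1_less)
      finally show "Polynomial.degree (\<Prod>w\<in>Z - {z}. [:-w, 1:]) < i" using cardZ \<open>i \<ge> n\<close> by simp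
    qed
    then show ?thesis by (simp add: G_def Polynomial.coeff_sum)
  qed
  have Gz: "poly G z = poly H z * poly (pderiv F) z" if z: "z \<in> Z" for z
  proof -
    have "poly G z = (\<Sum>v\<in>Z. poly H v * (\<Prod>w\<in>Z - {v}. z - w))"
      by (simp add: G_def poly_sum poly_prod)
    also have "\<dots> = (\<Sum>v\<in>{z}. poly H v * (\<Prod>w\<in>Z - {v}. z - w))"
      using finZ z by (intro sum.mono_neutral_right) (auto simp: prod_zero_iff)
    finally show ?thesis unfolding Fdec using poly_pderiv_prod_linear[OF finZ z] by simp
  qed
  have gz: "poly (map_poly to_ac g) z = poly H z * poly (pderiv F) z" if z: "z \<in> Z" for z
  proof -
    have "H * pderiv F = map_poly to_ac q * F + map_poly to_ac g"
      unfolding H_def F_def using g(3)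
      by (simp flip: map_poly_to_ac_pderiv map_poly_to_ac_mult map_poly_to_ac_add)
    then have "poly (H * pderiv F) z = poly (map_poly to_ac q * F + map_poly to_ac g) z" by simp
    then show ?thesis using z by (simp add: Z_def)
  qed
  \<comment> \<open>Both polynomials have no coefficients from degree \<open>n\<close> on and agree
    at the \<open>n\<close> distinct elements of \<open>Z\<close>.\<close>
  have "map_poly to_ac g - G = 0" (is "?D = 0")
  proof (rule ccontr)
    assume D: "?D \<noteq> 0"
    have "Polynomial.coeff ?D i = 0" if "i \<ge> n" for i using that by (simp add: coeff_map_poly g(4) Gn)
    then have "Polynomial.degree ?D < n" using D by (metis leading_coeff_0_iff linorder_not_less)
    moreover have "Z \<subseteq> {z. poly ?D z = 0}" using Gz gz by auto
    then have "card Z \<le> card {z. poly ?D z = 0}" using poly_roots_finite[OF D] by (intro card_mono)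
    moreover have "card {z. poly ?D z = 0} \<le> Polynomial.degree ?D" by (rule card_poly_roots_bound[OF D])
    ultimately show False using cardZ by simp
  qed
  then have "to_ac (Polynomial.coeff g i) = Polynomial.coeff G i" for i
    by (metis coeff_map_poly eq_iff_diff_eq_0 to_ac_0)
  then have "integral_over A (Polynomial.coeff g i)" for i
    using polys_overD[OF GI, of i] by (auto simp: integral_closure_def intro: integral_over_to_acD)
  \<comment> \<open>The coefficients are integral over \<open>A\<close> because they are those of
    \<open>G\<close>, and they lie in the field of fractions because they are those of
    \<open>g\<close>.\<close>
  then have gA: "Polynomial.coeff g i \<in> A" for i using polys_overD[OF g(2)] int_closed by blast
  have "poly (pderiv f) \<alpha> * y = poly g \<alpha>"
    using arg_cong[OF g(3), of "\<lambda>p. poly p \<alpha>"] fK(3) h(2) by (simp add: mult.commute)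
  also have "\<dots> = (\<Sum>i<n. Polynomial.coeff g i * \<alpha> ^ i)"
  proof -
    have "poly g \<alpha> = (\<Sum>i\<le>Polynomial.degree g. Polynomial.coeff g i * \<alpha> ^ i)" by (rule poly_altdef)
    also have "\<dots> = (\<Sum>i<n. Polynomial.coeff g i * \<alpha> ^ i)"
      by (rule sum.mono_neutral_cong) (auto simp: g(4) coeff_eq_0 not_less not_le)
    finally show ?thesis .
  qed
  also have "\<dots> \<in> span_over A ((\<lambda>i. \<alpha> ^ i) ` {..<n})"
    using gA by (intro submodule_sum[OF submodule_span_over] span_over_scale span_over_base) auto
  finally show ?thesis unfolding n_def .
qed

end

text \<open>The derivative at \<alpha> is the product of the differences between \<alpha> and the
  other roots, none of which is zero.\<close>

lemma poly_pderiv_nonzero_of_rsquarefree: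
  assumes "rsquarefree (map_poly to_ac f)" "Polynomial.lead_coeff f = 1" "poly f \<alpha> = 0"
  shows "poly (pderiv f) \<alpha> \<noteq> 0"
proof
  assume d: "poly (pderiv f) \<alpha> = 0"
  define F where "F = map_poly to_ac f"
  define Z where "Z = {z. poly F z = 0}"
  have F1: "Polynomial.lead_coeff F = 1" using assms by (simp add: F_def coeff_map_poly)
  have F: "F = (\<Prod>z\<in>Z. [:-z, 1:])"
    using alg_closed_rsquarefree_decompose[of F] assms F1 by (simp add: F_def Z_def)
  have finZ: "finite Z" unfolding Z_def using F1 by (intro poly_roots_finite) auto
  have \<alpha>Z: "to_ac \<alpha> \<in> Z" using assms(3) by (simp add: Z_def F_def poly_map_poly_to_ac)
  have "poly (pderiv F) (to_ac \<alpha>) = 0"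
    using d by (simp add: F_def poly_map_poly_to_ac flip: map_poly_to_ac_pderiv)
  moreover have "poly (pderiv F) (to_ac \<alpha>) = (\<Prod>w\<in>Z - {to_ac \<alpha>}. to_ac \<alpha> - w)"
    unfolding F by (rule poly_pderiv_prod_linear[OF finZ \<alpha>Z])
  ultimately show False using finZ by (simp add: prod_zero_iff)
qed

section \<open>Dedekind rings\<close>

definition prime_ideal_of :: "'a::field set \<Rightarrow> 'a set \<Rightarrow> bool" where
  "prime_ideal_of R P \<longleftrightarrow> submodule_over R P \<and> P \<subseteq> R \<and> 1 \<notin> P \<and> (\<forall>x\<in>R. \<forall>y\<in>R. x * y \<in> P \<longrightarrow> x \<in> P \<or> y \<in> P)"

text \<open>Maximality is phrased as the residue ring being a field, the form in which it is used
  throughout.\<close>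

definition maximal_ideal_of :: "'a::field set \<Rightarrow> 'a set \<Rightarrow> bool" where
  "maximal_ideal_of R M \<longleftrightarrow> submodule_over R M \<and> M \<subseteq> R \<and> 1 \<notin> M \<and> (\<forall>x\<in>R - M. \<exists>r\<in>R. r * x - 1 \<in> M)"

lemma maximal_ideal_inverse: "maximal_ideal_of R M \<Longrightarrow> x \<in> R \<Longrightarrow> x \<notin> M \<Longrightarrow> \<exists>r\<in>R. r * x - 1 \<in> M"
  by (auto simp: maximal_ideal_of_def)

text \<open>Only products of single elements, without their sums: these generate the product ideal
  and suffice to test whether it lies in a given ideal.\<close>

fun list_products :: "'a::field set list \<Rightarrow> 'a set" where
  "list_products [] = {1}"
| "list_products (P # Ps) = {x * y | x y. x \<in> P \<and> y \<in> list_products Ps}"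

lemma list_products_append:
  "x \<in> list_products (Ps @ Qs) \<longleftrightarrow> (\<exists>y\<in>list_products Ps. \<exists>z\<in>list_products Qs. x = y * z)"
proof (induction Ps arbitrary: x)
  case (Cons P Ps)
  show ?case
  proof
    assume "x \<in> list_products ((P # Ps) @ Qs)"
    then obtain a y z where "a \<in> P" "y \<in> list_products Ps" "z \<in> list_products Qs" "x = a * (y * z)"
      using Cons by auto
    then show "\<exists>y\<in>list_products (P # Ps). \<exists>z\<in>list_products Qs. x = y * z"
      by (intro bexI[of _ "a * y"] bexI[of _ z]) auto
  next
    assume "\<exists>y\<in>list_products (P # Ps). \<exists>z\<in>list_products Qs. x = y * z"
    then obtain a y z where "a \<in> P" "y \<in> list_products Ps" "z \<in> list_products Qs" "x = a * y * z"
      by auto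
    then show "x \<in> list_products ((P # Ps) @ Qs)"
      using Cons[of "y * z"] by (auto simp: mult.assoc)
  qed
qed auto

section \<open>Maximal ideals and the Chinese remainder theorem\<close>

context field_subring
begin

lemma submodule_add_principal:
  "submodule_over R I \<Longrightarrow> submodule_over R {i + r * x | i r. i \<in> I \<and> r \<in> R}"
  (is "_ \<Longrightarrow> submodule_over R ?J")
proof (rule submodule_overI)
  assume I: "submodule_over R I"
  show "0 \<in> ?J" using submodule_zero[OF I] by (auto intro!: exI[of _ 0])
next
  fix a b assume I: "submodule_over R I" and "a \<in> ?J" "b \<in> ?J"
  then obtain i r j s where "a = i + r * x" "b = j + s * x" "i \<in> I" "j \<in> I" "r \<in> R" "s \<in> R" by auto
  then show "a + b \<in> ?J"
    using submodule_add[OF I] by (intro CollectI exI[of _ "i + j"] exI[of _ "r + s"]) (auto simp: algebra_simps)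
next
  fix t a assume I: "submodule_over R I" and "t \<in> R" "a \<in> ?J"
  then obtain i r where "a = i + r * x" "i \<in> I" "r \<in> R" by auto
  then show "t * a \<in> ?J"
    using submodule_scale[OF I] \<open>t \<in> R\<close>
    by (intro CollectI exI[of _ "t * i"] exI[of _ "t * r"]) (auto simp: distrib_left mult.assoc)
qed

lemma submodule_principal: "submodule_over R {r * m | r. r \<in> R}"
proof (rule submodule_overI)
  show "0 \<in> {r * m | r. r \<in> R}" by (auto intro!: exI[of _ 0])
next
  fix x y assume "x \<in> {r * m | r. r \<in> R}" "y \<in> {r * m | r. r \<in> R}"
  then obtain r s where "x = r * m" "y = s * m" "r \<in> R" "s \<in> R" by auto
  then show "x + y \<in> {r * m | r. r \<in> R}" by (intro CollectI exI[of _ "r + s"]) (auto simp: algebra_simps)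
next
  fix t x assume "t \<in> R" "x \<in> {r * m | r. r \<in> R}"
  then obtain r where "x = r * m" "r \<in> R" by auto
  then show "t * x \<in> {r * m | r. r \<in> R}" using \<open>t \<in> R\<close> by (intro CollectI exI[of _ "t * r"]) auto
qed

lemma subset_add_principal: "I \<subseteq> {i + r * x | i r. i \<in> I \<and> r \<in> R}"
proof
  fix i assume "i \<in> I"
  then show "i \<in> {i + r * x | i r. i \<in> I \<and> r \<in> R}"
    by (intro CollectI exI[of _ i] exI[of _ 0]) auto
qed

lemma mem_add_principal: "submodule_over R I \<Longrightarrow> x \<in> {i + r * x | i r. i \<in> I \<and> r \<in> R}"
  by (intro CollectI exI[of _ 0] exI[of _ 1]) (auto simp: submodule_zero)

lemma maximal_ideal_imp_prime:
  assumes "maximal_ideal_of R M"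
  shows "prime_ideal_of R M"
proof -
  have M: "submodule_over R M" "M \<subseteq> R" "1 \<notin> M" using assms by (auto simp: maximal_ideal_of_def)
  have "y \<in> M" if xy: "x \<in> R" "y \<in> R" "x * y \<in> M" "x \<notin> M" for x y
  proof -
    obtain r where r: "r \<in> R" "r * x - 1 \<in> M" using maximal_ideal_inverse[OF assms xy(1,4)] by blast
    have "r * (x * y) - y * (r * x - 1) \<in> M"
      by (rule submodule_diff[OF M(1) submodule_scale[OF M(1) r(1) xy(3)] submodule_scale[OF M(1) xy(2) r(2)]])
    then show ?thesis by (simp add: algebra_simps)
  qed
  then show ?thesis using M by (auto simp: prime_ideal_of_def)
qed

lemma maximal_ideal_subset_eq:
  assumes "maximal_ideal_of R M" "prime_ideal_of R P" "M \<subseteq> P"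
  shows "M = P"
proof (rule ccontr)
  assume "M \<noteq> P"
  then obtain x where x: "x \<in> P" "x \<notin> M" using assms by auto
  have P: "submodule_over R P" "P \<subseteq> R" "1 \<notin> P" using assms(2) by (auto simp: prime_ideal_of_def)
  obtain r where r: "r \<in> R" "r * x - 1 \<in> M" using maximal_ideal_inverse[OF assms(1), of x] x P by blast
  then have "r * x - 1 \<in> P" using assms(3) by blast
  then have "r * x - (r * x - 1) \<in> P" by (rule submodule_diff[OF P(1) submodule_scale[OF P(1) r(1) x(1)]])
  then show False using P by simp
qed

text \<open>Distinct maximal ideals are comaximal, so some \<open>u M M'\<close> is 0 modulo
  \<open>M'\<close> and 1 modulo \<open>M\<close>. The products \<open>e M\<close> of these are 1
  modulo \<open>M\<close> and 0 modulo the other members of \<open>Q\<close>, and serve as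
  interpolation weights.\<close>

lemma chinese_remainder:
  assumes fin: "finite Q" and max: "\<And>M. M \<in> Q \<Longrightarrow> maximal_ideal_of R M" and a: "\<And>M. M \<in> Q \<Longrightarrow> a M \<in> R"
  obtains x where "x \<in> R" "\<And>M. M \<in> Q \<Longrightarrow> x - a M \<in> M"
proof -
  have "\<exists>u. u \<in> M' \<and> u - 1 \<in> M" if MM': "M \<in> Q" "M' \<in> Q" "M \<noteq> M'" for M M'
  proof -
    have "\<not> M' \<subseteq> M" using maximal_ideal_subset_eq[OF max maximal_ideal_imp_prime[OF max]] that by blast
    then obtain x where x: "x \<in> M'" "x \<notin> M" by blast
    have M': "submodule_over R M'" "M' \<subseteq> R" using max[OF that(2)] by (auto simp: maximal_ideal_of_def)
    obtain r where "r \<in> R" "r * x - 1 \<in> M" using maximal_ideal_inverse[OF max[OF MM'(1)], of x] x M' by blast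
    then show ?thesis using M' x by (intro exI[of _ "r * x"]) (auto intro: submodule_scale)
  qed
  then obtain u where u: "\<And>M M'. M \<in> Q \<Longrightarrow> M' \<in> Q \<Longrightarrow> M \<noteq> M' \<Longrightarrow> u M M' \<in> M' \<and> u M M' - 1 \<in> M" by metis
  define e where "e M = (\<Prod>M'\<in>Q - {M}. u M M')" for M
  have uR: "u M M' \<in> R" if "M \<in> Q" "M' \<in> Q - {M}" for M M'
    using u[of M M'] that max[of M'] by (auto simp: maximal_ideal_of_def)
  have e1: "e M - 1 \<in> M" if "M \<in> Q" for M
  proof -
    have M: "submodule_over R M" using max[OF that] by (auto simp: maximal_ideal_of_def)
    have "(\<Prod>M'\<in>S. u M M') - 1 \<in> M" if "S \<subseteq> Q - {M}" "finite S" for S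
      using that(2,1)
    proof (induction S rule: finite_induct)
      case empty
      show ?case using submodule_zero[OF M] by simp
    next
      case (insert N S)
      have "u M N * ((\<Prod>M'\<in>S. u M M') - 1) + (u M N - 1) \<in> M"
        using insert \<open>M \<in> Q\<close> u[of M N] uR[of M N] by (intro submodule_add[OF M] submodule_scale[OF M]) auto
      then show ?case using insert by (simp add: algebra_simps)
    qed
    then show ?thesis unfolding e_def using fin by blast
  qed
  have eM': "e M \<in> M'" if "M \<in> Q" "M' \<in> Q" "M \<noteq> M'" for M M'
  proof -
    have "e M = (\<Prod>N\<in>Q - {M} - {M'}. u M N) * u M M'"
      unfolding e_def using fin that by (subst prod.remove[of _ M']) (auto simp: mult.commute)
    moreover have "(\<Prod>N\<in>Q - {M} - {M'}. u M N) \<in> R" using uR that by (intro prod_mem) auto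
    ultimately show ?thesis using u[OF that] max[OF that(2)] by (auto simp: maximal_ideal_of_def intro: submodule_scale)
  qed
  have eR: "e M \<in> R" if "M \<in> Q" for M unfolding e_def using uR that by (intro prod_mem) auto
  define x where "x = (\<Sum>M\<in>Q. a M * e M)"
  show ?thesis
  proof (rule that[of x])
    show "x \<in> R" unfolding x_def using a eR by (intro sum_mem) auto
    fix M assume M: "M \<in> Q"
    have mM: "submodule_over R M" using max[OF M] by (auto simp: maximal_ideal_of_def)
    have "x - a M = a M * (e M - 1) + (\<Sum>M'\<in>Q - {M}. a M' * e M')"
      unfolding x_def using fin M by (subst sum.remove[of _ M]) (auto simp: algebra_simps)
    also have "\<dots> \<in> M"
      using a M e1 eM' by (intro submodule_add[OF mM] submodule_scale[OF mM] submodule_sum[OF mM]) auto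
    finally show "x - a M \<in> M" .
  qed
qed

end

section \<open>Dedekind rings: Noetherian arguments and inverses of ideals\<close>

locale dedekind_ring = integrally_closed_subring R for R :: "'a::field set" +
  assumes noetherian: "submodule_over R I \<Longrightarrow> I \<subseteq> R \<Longrightarrow> \<exists>S. finite S \<and> I = span_over R S"
    and nonzero_prime_maximal: "prime_ideal_of R P \<Longrightarrow> P \<noteq> {0} \<Longrightarrow> maximal_ideal_of R P"
begin

text \<open>The ascending chain condition as well-foundedness of reverse inclusion. The union of a
  strictly increasing chain is finitely generated, so its generators already lie in one
  member.\<close>

lemma wf_ideals: "wf {(J, I). submodule_over R I \<and> submodule_over R J \<and> J \<subseteq> R \<and> I \<subset> J}"
  unfolding wf_iff_no_infinite_down_chain
proof
  assume "\<exists>f. \<forall>i. (f (Suc i), f i) \<in> {(J, I). submodule_over R I \<and> submodule_over R J \<and> J \<subseteq> R \<and> I \<subset> J}"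
  then obtain f where "\<forall>i. (f (Suc i), f i) \<in> {(J, I). submodule_over R I \<and> submodule_over R J \<and> J \<subseteq> R \<and> I \<subset> J}"
    by blast
  then have f: "\<And>i. submodule_over R (f i)" "\<And>i. f (Suc i) \<subseteq> R" "\<And>i. f i \<subset> f (Suc i)" by auto
  have "f i \<subseteq> f (Suc i)" for i using f(3) by blast
  then have inc: "f i \<subseteq> f j" if "i \<le> j" for i j
    using that by (rule lift_Suc_mono_le)
  define U where "U = (\<Union>i. f i)"
  have "submodule_over R U"
  proof (rule submodule_overI)
    fix x y assume "x \<in> U" "y \<in> U"
    then obtain i j where "x \<in> f i" "y \<in> f j" by (auto simp: U_def)
    then have "x \<in> f (max i j)" "y \<in> f (max i j)" using inc by (meson max.cobounded1 max.cobounded2 subsetD)+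
    then show "x + y \<in> U" using submodule_add[OF f(1)] by (auto simp: U_def)
  next
    fix r x assume "r \<in> R" "x \<in> U"
    then obtain i where "x \<in> f i" by (auto simp: U_def)
    then have "r * x \<in> f i" using submodule_scale[OF f(1) \<open>r \<in> R\<close>] by blast
    then show "r * x \<in> U" by (auto simp: U_def)
  qed (use submodule_zero[OF f(1)] in \<open>auto simp: U_def\<close>)
  moreover have "f i \<subseteq> R" for i using f(2,3) by blast
  then have "U \<subseteq> R" by (auto simp: U_def)
  ultimately obtain S where S: "finite S" "U = span_over R S" using noetherian by blast
  have "\<exists>n. S \<subseteq> f n"
  proof -
    have "S \<subseteq> U" using S span_over_base by auto
    then have "\<forall>s\<in>S. \<exists>n. s \<in> f n" by (auto simp: U_def)
    then obtain k where k: "\<And>s. s \<in> S \<Longrightarrow> s \<in> f (k s)" by metis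
    have "s \<in> f (Max (k ` S))" if "s \<in> S" for s
      using k[OF that] inc[of "k s" "Max (k ` S)"] S(1) that by auto
    then show ?thesis by blast
  qed
  then obtain n where "S \<subseteq> f n" by blast
  then have "U \<subseteq> f n" unfolding S(2) by (intro span_over_least f)
  then have "f (Suc n) \<subseteq> f n" by (auto simp: U_def)
  with f(3) show False by blast
qed

lemma maximal_element_of_ideals:
  assumes "I\<^sub>0 \<in> Q" "\<And>I. I \<in> Q \<Longrightarrow> submodule_over R I \<and> I \<subseteq> R"
  obtains I where "I \<in> Q" "\<And>J. J \<in> Q \<Longrightarrow> I \<subseteq> J \<Longrightarrow> J = I"
proof -
  obtain I where I: "I \<in> Q" "\<And>J. (J, I) \<in> {(J, I). submodule_over R I \<and> submodule_over R J \<and> J \<subseteq> R \<and> I \<subset> J} \<Longrightarrow> J \<notin> Q"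
    by (rule wfE_min[OF wf_ideals assms(1)]) (rule that)
  have "J = I" if J: "J \<in> Q" "I \<subseteq> J" for J
  proof (rule ccontr)
    assume "J \<noteq> I"
    then have "(J, I) \<in> {(J, I). submodule_over R I \<and> submodule_over R J \<and> J \<subseteq> R \<and> I \<subset> J}"
      using assms(2)[OF J(1)] assms(2)[OF I(1)] J(2) by auto
    then show False using I(2) J(1) by blast
  qed
  with I(1) show ?thesis by (rule that)
qed

text \<open>Take \<open>M\<close> maximal among the ideals that contain \<open>I\<close> but not 1.
  For \<open>x\<close> outside \<open>M\<close> the ideal \<open>M + R x\<close> must contain 1,
  which yields an inverse of \<open>x\<close> modulo \<open>M\<close>.\<close>

lemma maximal_ideal_containing:
  assumes "submodule_over R I" "I \<subseteq> R" "1 \<notin> I"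
  obtains M where "maximal_ideal_of R M" "I \<subseteq> M"
proof -
  define Q where "Q = {J. submodule_over R J \<and> J \<subseteq> R \<and> I \<subseteq> J \<and> 1 \<notin> J}"
  have "I \<in> Q" using assms by (auto simp: Q_def)
  moreover have "\<And>J. J \<in> Q \<Longrightarrow> submodule_over R J \<and> J \<subseteq> R" by (auto simp: Q_def)
  ultimately obtain M where M: "M \<in> Q" "\<And>J. J \<in> Q \<Longrightarrow> M \<subseteq> J \<Longrightarrow> J = M"
    using maximal_element_of_ideals by metis
  have MQ: "submodule_over R M" "M \<subseteq> R" "I \<subseteq> M" "1 \<notin> M" using M(1) by (auto simp: Q_def)
  have "\<exists>r\<in>R. r * x - 1 \<in> M" if x: "x \<in> R" "x \<notin> M" for x
  proof -
    define J where "J = {i + r * x | i r. i \<in> M \<and> r \<in> R}"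
    have J: "submodule_over R J" unfolding J_def using MQ(1) by (rule submodule_add_principal)
    have "J \<subseteq> R" using MQ x by (auto simp: J_def)
    moreover have MJ: "M \<subseteq> J" unfolding J_def by (rule subset_add_principal)
    moreover have "x \<in> J" unfolding J_def using MQ(1) by (rule mem_add_principal)
    ultimately have "J \<notin> Q" using M(2)[of J] x by auto
    then have "1 \<in> J" using J \<open>J \<subseteq> R\<close> MJ MQ by (auto simp: Q_def)
    then obtain i r where ir: "1 = i + r * x" "i \<in> M" "r \<in> R" by (auto simp: J_def)
    have "r * x - 1 = - i" using ir(1) by (simp add: algebra_simps)
    then show ?thesis using ir submodule_uminus[OF MQ(1)] by metis
  qed
  then have "maximal_ideal_of R M" using MQ by (auto simp: maximal_ideal_of_def)
  then show ?thesis using that MQ(3) by blast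
qed

text \<open>Noetherian induction. A maximal counterexample \<open>J\<close> omits 1, as the empty
  list would serve, and is not prime, as the list \<open>[J]\<close> would serve. So it contains
  some \<open>x * y\<close> without either factor; lists for \<open>J + R x\<close> and
  \<open>J + R y\<close> concatenate to one for \<open>J\<close>.\<close>

lemma ideal_contains_products:
  assumes "submodule_over R I" "I \<subseteq> R" "I \<noteq> {0}"
  obtains Ps where "\<And>P. P \<in> set Ps \<Longrightarrow> maximal_ideal_of R P" "list_products Ps \<subseteq> I"
proof (rule ccontr)
  define good where "good I \<longleftrightarrow> (\<exists>Ps. (\<forall>P\<in>set Ps. maximal_ideal_of R P) \<and> list_products Ps \<subseteq> I)" for I
  define Q where "Q = {J. submodule_over R J \<and> J \<subseteq> R \<and> J \<noteq> {0} \<and> \<not> good J}"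
  assume "\<not> thesis"
  then have "I \<in> Q" using assms that by (auto simp: Q_def good_def)
  moreover have "\<And>J. J \<in> Q \<Longrightarrow> submodule_over R J \<and> J \<subseteq> R" by (auto simp: Q_def)
  ultimately obtain J where J: "J \<in> Q" and max: "\<And>J'. J' \<in> Q \<Longrightarrow> J \<subseteq> J' \<Longrightarrow> J' = J"
    using maximal_element_of_ideals by metis
  have JQ: "submodule_over R J" "J \<subseteq> R" "J \<noteq> {0}" "\<not> good J" using J by (auto simp: Q_def)
  have "1 \<notin> J"
  proof
    assume "1 \<in> J"
    then have "good J" unfolding good_def by (intro exI[of _ "[]"]) auto
    with JQ show False by blast
  qed
  moreover have "\<not> prime_ideal_of R J"
  proof
    assume "prime_ideal_of R J"
    then have "maximal_ideal_of R J" using JQ nonzero_prime_maximal by blast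
    then have "good J" unfolding good_def using JQ(1)
      by (intro exI[of _ "[J]"]) (auto simp: submodule_over_def mult.commute)
    with JQ show False by blast
  qed
  ultimately obtain x y where xy: "x \<in> R" "y \<in> R" "x * y \<in> J" "x \<notin> J" "y \<notin> J"
    using JQ by (auto simp: prime_ideal_of_def)
  have good_add: "good {i + r * z | i r. i \<in> J \<and> r \<in> R}" if z: "z \<in> R" "z \<notin> J" for z
  proof (rule ccontr)
    let ?J' = "{i + r * z | i r. i \<in> J \<and> r \<in> R}"
    assume "\<not> good ?J'"
    moreover have "submodule_over R ?J'" using JQ(1) by (rule submodule_add_principal)
    moreover have "?J' \<subseteq> R" using JQ z by auto
    moreover have JJ': "J \<subseteq> ?J'" by (rule subset_add_principal)
    moreover have "?J' \<noteq> {0}" using JJ' JQ(3) submodule_zero[OF JQ(1)] by blast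
    ultimately have "?J' = J" using max by (auto simp: Q_def)
    moreover have "z \<in> ?J'" using JQ(1) by (rule mem_add_principal)
    ultimately show False using z by blast
  qed
  obtain Ps where Ps: "\<forall>P\<in>set Ps. maximal_ideal_of R P" "list_products Ps \<subseteq> {i + r * x | i r. i \<in> J \<and> r \<in> R}"
    using good_add[of x] xy by (auto simp: good_def)
  obtain Qs where Qs: "\<forall>P\<in>set Qs. maximal_ideal_of R P" "list_products Qs \<subseteq> {i + r * y | i r. i \<in> J \<and> r \<in> R}"
    using good_add[of y] xy by (auto simp: good_def)
  have "list_products (Ps @ Qs) \<subseteq> J"
  proof
    fix a assume "a \<in> list_products (Ps @ Qs)"
    then obtain b c where bc: "b \<in> list_products Ps" "c \<in> list_products Qs" "a = b * c"
      by (auto simp: list_products_append)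
    obtain i r where "i \<in> J" "r \<in> R" "b = i + r * x" using subsetD[OF Ps(2) bc(1)] by blast
    moreover obtain j s where "j \<in> J" "s \<in> R" "c = j + s * y" using subsetD[OF Qs(2) bc(2)] by blast
    ultimately have h: "i \<in> J" "r \<in> R" "j \<in> J" "s \<in> R" "a = (i + r * x) * (j + s * y)"
      using bc(3) by auto
    have "a = (j + s * y) * i + ((r * x) * j + (r * s) * (x * y))" by (simp add: h algebra_simps)
    also have "\<dots> \<in> J"
    proof (intro submodule_add[OF JQ(1)])
      have "j + s * y \<in> R" "r * x \<in> R" "r * s \<in> R" using h xy JQ(2) by auto
      then show "(j + s * y) * i \<in> J" "(r * x) * j \<in> J" "(r * s) * (x * y) \<in> J"
        using submodule_scale[OF JQ(1)] h xy by blast+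
    qed
    finally show "a \<in> J" .
  qed
  then have "good J" using Ps Qs unfolding good_def by (intro exI[of _ "Ps @ Qs"]) auto
  with JQ show False by blast
qed

text \<open>Either the first ideal lies in \<open>P\<close>, hence equals it, or it has an element
  outside \<open>P\<close> that can be cancelled from all products.\<close>

lemma prime_contains_factor:
  assumes "prime_ideal_of R P" "\<And>M. M \<in> set Ms \<Longrightarrow> maximal_ideal_of R M" "list_products Ms \<subseteq> P"
  shows "P \<in> set Ms"
  using assms(2,3)
proof (induction Ms)
  case Nil
  then show ?case using assms(1) by (simp add: prime_ideal_of_def)
next
  case (Cons M Ms)
  show ?case
  proof (cases "M \<subseteq> P")
    case True
    then show ?thesis using maximal_ideal_subset_eq[OF _ assms(1)] Cons.prems(1) by auto
  next
    case False
    then obtain x where x: "x \<in> M" "x \<notin> P" by blast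
    have MR: "N \<subseteq> R" if "N \<in> set (M # Ms)" for N using Cons.prems(1)[OF that] by (simp add: maximal_ideal_of_def)
    have "list_products Ns \<subseteq> R" if "set Ns \<subseteq> set (M # Ms)" for Ns
      using that by (induction Ns) (use MR in \<open>auto\<close>)
    then have "list_products Ms \<subseteq> R" by (metis set_subset_Cons)
    moreover have "x * y \<in> P" if "y \<in> list_products Ms" for y
      using Cons.prems(2) x that by auto
    ultimately have "y \<in> P" if "y \<in> list_products Ms" for y
      using assms(1) x that MR[of M] unfolding prime_ideal_of_def by (meson in_mono list.set_intros(1))
    then show ?thesis using Cons by auto
  qed
qed

text \<open>The principal ideal of \<open>m\<close> contains the products of some list of maximal
  ideals, and every maximal ideal containing \<open>m\<close> occurs in that list.\<close>

lemma finite_maximal_ideals_containing: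
  assumes "m \<in> R" "m \<noteq> 0"
  shows "finite {M. maximal_ideal_of R M \<and> m \<in> M}"
proof -
  let ?I = "{r * m | r. r \<in> R}"
  have "m \<in> ?I" by (auto intro!: exI[of _ 1])
  then have I0: "?I \<noteq> {0}" using assms(2) by blast
  have IR: "?I \<subseteq> R" using assms(1) by auto
  obtain Ps where Ps: "\<And>P. P \<in> set Ps \<Longrightarrow> maximal_ideal_of R P" "list_products Ps \<subseteq> ?I"
    by (rule ideal_contains_products[OF submodule_principal IR I0]) (rule that)
  have "M \<in> set Ps" if "maximal_ideal_of R M" "m \<in> M" for M
  proof -
    have "?I \<subseteq> M" using that by (auto simp: maximal_ideal_of_def intro: submodule_scale)
    then show ?thesis using prime_contains_factor[OF maximal_ideal_imp_prime[OF that(1)] Ps(1)] Ps(2) by blast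
  qed
  then have "{M. maximal_ideal_of R M \<and> m \<in> M} \<subseteq> set Ps" by blast
  then show ?thesis by (rule finite_subset) simp
qed

text \<open>Shows that the inverse fractional ideal of \<open>M\<close> is strictly larger than
  \<open>R\<close>. Choose \<open>a\<close> in \<open>M\<close> and a list of maximal ideals whose
  products lie in \<open>(a)\<close>. Omitting \<open>M\<close> from a shortest such list gives a
  product \<open>b\<close> outside \<open>(a)\<close>, and \<open>b / a\<close> has the required
  properties.\<close>

lemma maximal_ideal_inverse_not_integral:
  assumes M: "maximal_ideal_of R M" "M \<noteq> {0}"
  obtains z where "z \<in> fractions R" "z \<notin> R" "\<And>x. x \<in> M \<Longrightarrow> z * x \<in> R"
proof -
  have Mm: "submodule_over R M" "M \<subseteq> R" "1 \<notin> M" using M by (auto simp: maximal_ideal_of_def)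
  obtain a where a: "a \<in> M" "a \<noteq> 0" using M(2) submodule_zero[OF Mm(1)] by auto
  let ?I = "{r * a | r. r \<in> R}"
  define ok where "ok Ps \<longleftrightarrow> (\<forall>P\<in>set Ps. maximal_ideal_of R P) \<and> list_products Ps \<subseteq> ?I" for Ps
  have "a \<in> ?I" by (auto intro!: exI[of _ 1])
  then have I0: "?I \<noteq> {0}" using a(2) by blast
  have IR: "?I \<subseteq> R" using a Mm by auto
  obtain Ps\<^sub>0 where "ok Ps\<^sub>0"
    by (rule ideal_contains_products[OF submodule_principal IR I0]) (auto simp: ok_def intro: that)
  then obtain Ps where Ps: "ok Ps" and min: "\<And>Qs. ok Qs \<Longrightarrow> length Ps \<le> length Qs"
    using exists_least_iff[of "\<lambda>n. \<exists>Ps. ok Ps \<and> length Ps = n"] by (metis not_less)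
  have "?I \<subseteq> M" using a Mm by (auto intro: submodule_scale)
  then have "M \<in> set Ps" using Ps prime_contains_factor[OF maximal_ideal_imp_prime[OF M(1)], of Ps] by (auto simp: ok_def)
  then obtain us vs where uv: "Ps = us @ M # vs" by (meson split_list)
  have "\<not> ok (us @ vs)" using min[of "us @ vs"] by (auto simp: uv)
  then obtain b where b: "b \<in> list_products (us @ vs)" "b \<notin> ?I" using Ps by (auto simp: ok_def uv)
  then obtain u v where buv: "u \<in> list_products us" "v \<in> list_products vs" "b = u * v"
    by (auto simp: list_products_append)
  have bx: "b * x \<in> ?I" if "x \<in> M" for x
  proof -
    have "u * (x * v) \<in> list_products Ps"
      unfolding uv list_products_append using that buv by auto
    then have "u * (x * v) \<in> ?I" using Ps unfolding ok_def by blast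
    then show ?thesis by (simp add: buv mult_ac)
  qed
  have "b / a * a \<in> ?I" if "b / a \<in> R" using that by blast
  then have bR: "b / a \<notin> R" using b a by auto
  have "b / a * x \<in> R" if x: "x \<in> M" for x
  proof -
    obtain r where "b * x = r * a" "r \<in> R" using bx[OF x] by blast
    then show ?thesis using a by simp
  qed
  moreover have "b / a \<in> fractions R"
  proof -
    interpret K: field_subfield "fractions R" by (rule field_subfield_fractions)
    have "b / a * a \<in> R" using calculation a by blast
    then have "b \<in> R" using a by simp
    then show ?thesis using a Mm subset_fractions by auto
  qed
  ultimately show ?thesis using that bR by blast
qed

text \<open>
  Otherwise the elements \<open>\<theta>\<close> with \<open>\<theta> J \<subseteq> R\<close> form a finitely generated module stable under some
  \<open>z \<notin> R\<close> with \<open>z M \<subseteq> R\<close>, and \<open>z\<close> would be integral over \<open>R\<close>.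
\<close>

lemma fractional_ideal_not_in_maximal:
  assumes J: "submodule_over R J" "J \<noteq> {0}" and e: "e \<noteq> 0" "\<And>j. j \<in> J \<Longrightarrow> e * j \<in> R"
    and M: "maximal_ideal_of R M" "M \<noteq> {0}"
  obtains \<theta> j where "\<And>j. j \<in> J \<Longrightarrow> \<theta> * j \<in> R" "j \<in> J" "\<theta> * j \<notin> M"
proof (rule ccontr)
  note found = that
  assume neg: "\<not> thesis"
  define T where "T = {\<theta>. \<forall>j\<in>J. \<theta> * j \<in> R}"
  have TM: "\<theta> * j \<in> M" if \<theta>: "\<theta> \<in> T" and j: "j \<in> J" for \<theta> j
  proof (rule ccontr)
    assume "\<theta> * j \<notin> M"
    moreover have "\<And>i. i \<in> J \<Longrightarrow> \<theta> * i \<in> R" using \<theta> by (simp add: T_def)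
    ultimately have thesis using found[OF _ j] by blast
    with neg show False by contradiction
  qed
  obtain z where z: "z \<in> fractions R" "z \<notin> R" "\<And>x. x \<in> M \<Longrightarrow> z * x \<in> R"
    using maximal_ideal_inverse_not_integral[OF M] by blast
  have zT: "z * \<theta> \<in> T" if "\<theta> \<in> T" for \<theta>
  proof -
    have "z * (\<theta> * j) \<in> R" if "j \<in> J" for j using z(3) TM \<open>\<theta> \<in> T\<close> that by blast
    then show ?thesis by (simp add: T_def mult.assoc)
  qed
  obtain k where k: "k \<in> J" "k \<noteq> 0" using J submodule_zero by blast
  \<comment> \<open>Multiplication by a nonzero \<open>k\<close> from \<open>J\<close> turns
    \<open>T\<close> into an ideal of \<open>R\<close>, which is finitely generated. Division by
    \<open>k\<close> then gives generators \<open>W\<close> of \<open>T\<close>.\<close>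
  define kT where "kT = (\<lambda>\<theta>. k * \<theta>) ` T"
  have "submodule_over R T" by (rule submodule_overI) (auto simp: T_def distrib_right mult.assoc)
  then have "submodule_over R kT" unfolding kT_def by (rule submodule_image_mult)
  moreover have "kT \<subseteq> R" using k by (auto simp: kT_def T_def mult.commute)
  ultimately have "\<exists>S. finite S \<and> kT = span_over R S" by (rule noetherian)
  then obtain S where S: "finite S" "kT = span_over R S" by blast
  define W where "W = (\<lambda>s. s / k) ` S"
  have TW: "\<theta> \<in> span_over R W" if "\<theta> \<in> T" for \<theta>
  proof -
    have "k * \<theta> \<in> kT" using that by (auto simp: kT_def)
    then have "k * \<theta> \<in> span_over R S" using S(2) by simp
    then have "inverse k * (k * \<theta>) \<in> span_over R W"
      by (rule span_over_stable[rotated]) (auto simp: W_def divide_inverse mult.commute intro!: span_over_base)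
    moreover have "inverse k * (k * \<theta>) = \<theta>" using k(2) by (simp flip: mult.assoc)
    ultimately show ?thesis by simp
  qed
  have WT: "w \<in> T" if w: "w \<in> W" for w
  proof -
    obtain s where s: "s \<in> S" "w = s / k" using w by (auto simp: W_def)
    then have "s \<in> kT" unfolding S(2) by (intro span_over_base)
    then show ?thesis using s k by (auto simp: kT_def)
  qed
  have "e \<in> T" using e by (simp add: T_def)
  then obtain w where w: "w \<in> W" "w \<noteq> 0" using span_over_nonzero_generator[OF TW e(1)] by blast
  have "finite W" using S by (simp add: W_def)
  then have "integral_over R z" using integral_of_stable[OF _ w] TW WT zT by blast
  then show False using z int_closed by blast
qed

text \<open>The final equation says that \<theta> \<open>J\<close> is coprime to \<open>m\<close>.
  At each of the finitely many maximal ideals containing \<open>m\<close> there is a multiplier that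
  keeps \<open>J\<close> integral but not inside that ideal. These are glued with Chinese remainder
  weights, and the resulting ideal plus \<open>(m)\<close> lies in no maximal ideal.\<close>

lemma fractional_ideal_local_generator:
  assumes J: "submodule_over R J" "J \<noteq> {0}" and e: "e \<noteq> 0" "\<And>j. j \<in> J \<Longrightarrow> e * j \<in> R"
    and m: "m \<in> R" "m \<noteq> 0"
  obtains \<theta> j b where "\<And>j. j \<in> J \<Longrightarrow> \<theta> * j \<in> R" "j \<in> J" "b \<in> R" "\<theta> * j + b * m = 1"
proof -
  define Q where "Q = {M. maximal_ideal_of R M \<and> m \<in> M}"
  have fin: "finite Q" unfolding Q_def using m by (rule finite_maximal_ideals_containing)
  have Qm: "maximal_ideal_of R M" "submodule_over R M" "M \<noteq> {0}" "M \<subseteq> R" "1 \<notin> M" if "M \<in> Q" for M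
    using that m by (auto simp: Q_def maximal_ideal_of_def)
  have "\<exists>\<theta> j. (\<forall>j\<in>J. \<theta> * j \<in> R) \<and> j \<in> J \<and> \<theta> * j \<notin> M" if "M \<in> Q" for M
    using fractional_ideal_not_in_maximal[OF J e Qm(1,3)[OF that]] by metis
  then obtain \<theta> j where \<theta>: "\<And>M i. M \<in> Q \<Longrightarrow> i \<in> J \<Longrightarrow> \<theta> M * i \<in> R"
    and j: "\<And>M. M \<in> Q \<Longrightarrow> j M \<in> J" "\<And>M. M \<in> Q \<Longrightarrow> \<theta> M * j M \<notin> M" by metis
  have "\<exists>x. x \<in> R \<and> x - 1 \<in> M \<and> (\<forall>M'\<in>Q - {M}. x \<in> M')" if M: "M \<in> Q" for M
  proof -
    obtain x where x: "x \<in> R" "\<And>M'. M' \<in> Q \<Longrightarrow> x - (if M' = M then 1 else 0) \<in> M'"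
      by (rule chinese_remainder[OF fin Qm(1), of "\<lambda>M'. if M' = M then 1 else 0"]) auto
    have "x - 1 \<in> M" using x(2)[OF M] by simp
    moreover have "x \<in> M'" if "M' \<in> Q - {M}" for M' using x(2)[of M'] that by auto
    ultimately show ?thesis using x(1) by blast
  qed
  then obtain x where x: "\<And>M. M \<in> Q \<Longrightarrow> x M \<in> R" "\<And>M. M \<in> Q \<Longrightarrow> x M - 1 \<in> M"
    "\<And>M M'. M \<in> Q \<Longrightarrow> M' \<in> Q \<Longrightarrow> M' \<noteq> M \<Longrightarrow> x M \<in> M'" by (metis DiffI singletonD)
  define \<eta> where "\<eta> = (\<Sum>M\<in>Q. x M * \<theta> M)"
  have \<eta>J: "\<eta> * i \<in> R" if "i \<in> J" for i
  proof -
    have "\<eta> * i = (\<Sum>M\<in>Q. x M * (\<theta> M * i))" by (simp add: \<eta>_def sum_distrib_right mult.assoc)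
    also have "\<dots> \<in> R" by (rule sum_mem) (use x(1) \<theta> that in blast)
    finally show ?thesis .
  qed
  have mJ: "submodule_over R ((\<lambda>i. \<eta> * i) ` J)" using J(1) by (rule submodule_image_mult)
  define I where "I = {i + r * m | i r. i \<in> (\<lambda>i. \<eta> * i) ` J \<and> r \<in> R}"
  have "submodule_over R I" unfolding I_def using mJ by (rule submodule_add_principal)
  moreover have "I \<subseteq> R" using \<eta>J m by (auto simp: I_def)
  moreover have noM: False if M: "maximal_ideal_of R M" "I \<subseteq> M" for M
  proof -
    have "m \<in> I" unfolding I_def using submodule_zero[OF mJ] by (intro CollectI exI[of _ 0] exI[of _ 1]) auto
    then have MQ: "M \<in> Q" using M by (auto simp: Q_def)
    note rM = Qm(2)[OF MQ]
    have "\<eta> * j M \<in> I" unfolding I_def using j(1)[OF MQ] by (intro CollectI exI[of _ "\<eta> * j M"] exI[of _ 0]) auto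
    then have "\<eta> * j M \<in> M" using M by blast
    \<comment> \<open>Modulo \<open>M\<close> only the summand belonging to \<open>M\<close>
      survives, since the other weights lie in \<open>M\<close>.\<close>
    moreover have "\<eta> * j M = x M * (\<theta> M * j M) + (\<Sum>N\<in>Q - {M}. (\<theta> N * j M) * x N)"
    proof -
      have "\<eta> = x M * \<theta> M + (\<Sum>N\<in>Q - {M}. x N * \<theta> N)"
        unfolding \<eta>_def using fin MQ by (rule sum.remove)
      then show ?thesis by (simp add: distrib_left sum_distrib_left mult_ac)
    qed
    moreover have "(\<Sum>N\<in>Q - {M}. (\<theta> N * j M) * x N) \<in> M"
      by (rule submodule_sum[OF rM], rule submodule_scale[OF rM \<theta>[OF _ j(1)[OF MQ]] x(3)]) (use MQ in auto)
    ultimately have "x M * (\<theta> M * j M) \<in> M"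
      using submodule_diff[OF rM, of "\<eta> * j M" "\<Sum>N\<in>Q - {M}. (\<theta> N * j M) * x N"] by simp
    then have "x M \<in> M \<or> \<theta> M * j M \<in> M"
      using maximal_ideal_imp_prime[OF M(1)] x(1)[OF MQ] \<theta>[OF MQ j(1)[OF MQ]] unfolding prime_ideal_of_def by blast
    then have "x M \<in> M" using j(2)[OF MQ] by blast
    then have "x M - (x M - 1) \<in> M" using x(2)[OF MQ] by (rule submodule_diff[OF rM])
    then show False using Qm(5)[OF MQ] by simp
  qed
  ultimately have "1 \<in> I" using maximal_ideal_containing[of I] by metis
  then obtain i b where "i \<in> J" "b \<in> R" "1 = \<eta> * i + b * m" by (auto simp: I_def)
  then show ?thesis using that[of \<eta> i b] \<eta>J by auto
qed

end

section \<open>Separable extensions of a Dedekind ring\<close>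

context field_subring
begin

lemma poly_cong:
  assumes p: "p \<in> polys_over R" and I: "submodule_over R I" "x \<in> R" "y \<in> R" "x - y \<in> I"
  shows "poly p x - poly p y \<in> I"
  using p
proof (induction p)
  case 0
  then show ?case using submodule_zero[OF I(1)] by simp
next
  case (pCons a p)
  then have p: "p \<in> polys_over R" "poly p x - poly p y \<in> I" by (auto simp: polys_pCons_iff)
  have "x * (poly p x - poly p y) + poly p y * (x - y) \<in> I"
    using submodule_scale[OF I(1,2) p(2)] submodule_scale[OF I(1) poly_mem[OF p(1) I(3)] I(4)]
    by (rule submodule_add[OF I(1)])
  then show ?case by (simp add: algebra_simps)
qed

text \<open>As \<open>k\<close> is invertible modulo every member of \<open>Q\<close>, its multiples
  reach all residue classes. A nonroot can be prescribed at each \<open>q\<close> separately, and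
  the Chinese remainder theorem combines the choices.\<close>

lemma avoid_roots_mod_maximal_ideals:
  assumes f: "f \<in> polys_over R" and k: "k \<in> R"
    and fin: "finite Q" and Q: "\<And>q. q \<in> Q \<Longrightarrow> maximal_ideal_of R q" "\<And>q. q \<in> Q \<Longrightarrow> k \<notin> q"
    and ex: "\<And>q. q \<in> Q \<Longrightarrow> \<exists>z\<in>R. poly f z \<notin> q"
  obtains a where "a \<in> R" "\<And>q. q \<in> Q \<Longrightarrow> poly f (k * a) \<notin> q"
proof -
  have "\<exists>b z. b \<in> R \<and> z \<in> R \<and> poly f z \<notin> q \<and> k * b - z \<in> q" if q: "q \<in> Q" for q
  proof -
    have mq: "submodule_over R q" using Q(1)[OF q] by (simp add: maximal_ideal_of_def)
    obtain z where z: "z \<in> R" "poly f z \<notin> q" using ex[OF q] by blast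
    obtain r where r: "r \<in> R" "r * k - 1 \<in> q"
      using maximal_ideal_inverse[OF Q(1)[OF q] k Q(2)[OF q]] by blast
    have "z * (r * k - 1) \<in> q" using z(1) r(2) by (rule submodule_scale[OF mq])
    then have "k * (r * z) - z \<in> q" by (simp add: algebra_simps)
    then show ?thesis using z r by blast
  qed
  then obtain b z where b: "\<And>q. q \<in> Q \<Longrightarrow> b q \<in> R"
    and z: "\<And>q. q \<in> Q \<Longrightarrow> z q \<in> R \<and> poly f (z q) \<notin> q \<and> k * b q - z q \<in> q" by metis
  obtain a where a: "a \<in> R" "\<And>q. q \<in> Q \<Longrightarrow> a - b q \<in> q"
    by (rule chinese_remainder[OF fin Q(1) b]) (assumption | rule that)+
  have "poly f (k * a) \<notin> q" if q: "q \<in> Q" for q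
  proof
    assume h: "poly f (k * a) \<in> q"
    have mq: "submodule_over R q" using Q(1)[OF q] by (simp add: maximal_ideal_of_def)
    have zq: "z q \<in> R" "poly f (z q) \<notin> q" "k * b q - z q \<in> q" using z[OF q] by auto
    have "k * (a - b q) + (k * b q - z q) \<in> q"
      by (rule submodule_add[OF mq submodule_scale[OF mq k a(2)[OF q]] zq(3)])
    then have "k * a - z q \<in> q" by (simp add: algebra_simps)
    then have "poly f (k * a) - poly f (z q) \<in> q"
      by (rule poly_cong[OF f mq mult_mem[OF k a(1)] zq(1)])
    then have "poly f (k * a) - (poly f (k * a) - poly f (z q)) \<in> q"
      by (rule submodule_diff[OF mq h])
    with zq(2) show False by simp
  qed
  then show ?thesis using that a(1) by blast
qed

text \<open>A monic polynomial of degree \<open>n\<close> has at most \<open>n\<close> roots in the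
  domain \<open>R/P\<close>; the set \<open>T\<close> holds representatives of distinct classes. The
  induction splits off a factor \<open>X - x\<close>.\<close>

lemma monic_poly_nonzero_mod_prime:
  assumes P: "prime_ideal_of R P" and "f \<in> polys_over R" "Polynomial.lead_coeff f = 1"
    and "T \<subseteq> R" "Polynomial.degree f < card T"
    and "\<And>x y. x \<in> T \<Longrightarrow> y \<in> T \<Longrightarrow> x \<noteq> y \<Longrightarrow> x - y \<notin> P"
  shows "\<exists>a\<in>T. poly f a \<notin> P"
  using assms(2-)
proof (induction "Polynomial.degree f" arbitrary: f T)
  case 0
  then have "f = [:1:]" by (auto elim!: degree_eq_zeroE)
  moreover obtain a where "a \<in> T" using 0 by (auto simp: card_gt_0_iff)
  ultimately show ?case using P by (auto simp: prime_ideal_of_def)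
next
  case (Suc n)
  have mP: "submodule_over R P" using P by (simp add: prime_ideal_of_def)
  have "card T > 0" using Suc.prems(4) by simp
  then have T: "finite T" "T \<noteq> {}" by (auto simp: card_gt_0_iff)
  then obtain x where x: "x \<in> T" by blast
  show ?case
  proof (rule ccontr)
    assume "\<not> (\<exists>a\<in>T. poly f a \<notin> P)"
    then have fP: "\<And>a. a \<in> T \<Longrightarrow> poly f a \<in> P" by blast
    have xR: "x \<in> R" using x Suc.prems(3) by blast
    define l where "l = [:-x, 1:]"
    have l: "l \<in> polys_over R" "Polynomial.lead_coeff l = 1" "Polynomial.degree l = 1" "l \<noteq> 0"
      using xR by (auto simp: l_def intro!: polys_pCons)
    obtain g r where "g \<in> polys_over R" "r \<in> polys_over R" "f = g * l + r"
      and r: "\<And>i. i \<ge> Polynomial.degree l \<Longrightarrow> Polynomial.coeff r i = 0"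
      by (rule monic_division[OF l(1,2) Suc.prems(1)]) (rule that)
    then have g: "g \<in> polys_over R" "f = g * l + r" by blast+
    have degr: "Polynomial.degree r = 0"
      using r l(3) by (metis One_nat_def leading_coeff_0_iff Suc_leI degree_0 not_gr_zero)
    have g0: "g \<noteq> 0" using g(2) degr Suc.hyps(2) by auto
    have deg: "Polynomial.degree (g * l) = Suc (Polynomial.degree g)"
      using g0 l by (subst degree_mult_eq) auto
    have "Polynomial.degree f = Suc (Polynomial.degree g)"
      unfolding g(2) using deg degr by (subst degree_add_eq_left) auto
    moreover have "Polynomial.coeff f (Polynomial.degree (g * l)) = Polynomial.coeff (g * l) (Polynomial.degree (g * l))"
      unfolding g(2) using deg degr by (simp add: coeff_eq_0)
    then have "Polynomial.lead_coeff (g * l) = 1"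
      using Suc.prems(2) deg calculation by simp
    then have "Polynomial.lead_coeff g = 1" by (simp only: lead_coeff_mult l(2) mult_1_right)
    moreover have "Polynomial.degree g < card (T - {x})"
      using calculation(1) Suc.prems(4) x T by simp
    ultimately obtain a where a: "a \<in> T - {x}" "poly g a \<notin> P"
      using Suc.hyps(1)[of g "T - {x}"] Suc.hyps(2) g(1) Suc.prems(3,5) by (metis Diff_iff nat.inject subset_iff)
    \<comment> \<open>The remainder \<open>r\<close> is constant and cancels in this difference,
      leaving \<open>g(a) (a - x)\<close>, neither factor of which lies in \<open>P\<close>.\<close>
    have "poly f a - poly f x \<in> P" using fP a x by (intro submodule_diff[OF mP]) auto
    moreover have "poly r a = poly r x" using degr by (auto elim!: degree_eq_zeroE)
    then have "poly f a - poly f x = poly g a * (a - x)" unfolding g(2) by (simp add: l_def algebra_simps)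
    ultimately have "poly g a * (a - x) \<in> P" by simp
    moreover have "poly g a \<in> R" using poly_mem[OF g(1)] a Suc.prems(3) by blast
    moreover have "a - x \<in> R" using a xR Suc.prems(3) by blast
    moreover have "a - x \<notin> P" using a x Suc.prems(5) by blast
    ultimately show False using P a(2) unfolding prime_ideal_of_def by blast
  qed
qed

end

text \<open>The element \<open>t\<close> is a nonzero nonunit and records that \<open>A\<close> is
  not a field. The extension field is the whole type.\<close>

locale separable_dedekind_extension = dedekind_ring A for A :: "'a::field set" +
  fixes t :: 'a
  assumes t: "t \<in> A" "t \<noteq> 0" "inverse t \<notin> A"
    and sep: "separable_element (fractions A) x"
    and finite_ext: "\<exists>S. finite S \<and> span_over (fractions A) S = UNIV"
begin

abbreviation K where "K \<equiv> fractions A"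
abbreviation B where "B \<equiv> integral_closure A"

sublocale K: field_subfield "fractions A" by (rule field_subfield_fractions)

sublocale B: field_subring "integral_closure A" by (rule field_subring_integral_closure)

text \<open>Two equal powers of \<open>t\<close> with different exponents would make
  \<open>t\<close> a unit.\<close>

lemma infinite_A: "infinite A"
proof
  assume "finite A"
  moreover have "range (\<lambda>n::nat. t ^ n) \<subseteq> A" using t by auto
  ultimately have "finite (range (\<lambda>n::nat. t ^ n))" by (rule rev_finite_subset)
  then have "\<not> inj (\<lambda>n::nat. t ^ n)" using finite_imageD infinite_UNIV_nat by blast
  then obtain i j :: nat where "i \<noteq> j" "t ^ i = t ^ j" by (auto simp: inj_def)
  then obtain i j :: nat where ij: "i < j" "t ^ i = t ^ j" by (metis linorder_neqE_nat)
  have "t ^ i * 1 = t ^ i * (t * t ^ (j - i - 1))"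
  proof -
    have "j = i + Suc (j - i - 1)" using ij by simp
    then have "t ^ j = t ^ i * (t * t ^ (j - i - 1))" by (metis power_add power_Suc)
    then show ?thesis using ij by simp
  qed
  then have "t * t ^ (j - i - 1) = 1" using t(2) by simp
  then have "inverse t = t ^ (j - i - 1)" by (rule inverse_unique)
  then show False using t by auto
qed

lemma minimal_poly_ex: "\<exists>m. is_minimal_poly K x m"
  using sep[of x] by (auto simp: separable_element_def)

lemma clear_denominators_poly:
  assumes "p \<in> polys_over K"
  obtains a where "a \<in> A" "a \<noteq> 0" "Polynomial.smult a p \<in> polys_over A"
proof -
  have "\<exists>a\<in>A. a \<noteq> 0 \<and> Polynomial.smult a p \<in> polys_over A"
    using assms
  proof (induction p)
    case 0
    then show ?case by (intro bexI[of _ 1]) auto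
  next
    case (pCons c p)
    then obtain a where a: "a \<in> A" "a \<noteq> 0" "Polynomial.smult a p \<in> polys_over A"
      by (auto simp: K.polys_pCons_iff)
    obtain u v where uv: "c = u / v" "u \<in> A" "v \<in> A" "v \<noteq> 0"
      using pCons.prems K.polys_pCons_iff[of c p] by (auto simp: fractions_def)
    have "Polynomial.smult (v * a) (pCons c p) = pCons (a * u) (Polynomial.smult v (Polynomial.smult a p))"
      using uv by simp
    moreover have "\<dots> \<in> polys_over A"
      by (rule polys_pCons[OF mult_mem[OF a(1) uv(2)] polys_smult[OF uv(3) a(3)]])
    ultimately show ?case using a uv by (intro bexI[of _ "v * a"]) auto
  qed
  then show ?thesis using that by blast
qed

text \<open>If \<open>a\<close> clears the denominators of a monic equation of degree
  \<open>n\<close> for \<open>x\<close>, multiplying that equation by \<open>a ^ n\<close> gives a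
  monic equation over \<open>A\<close> for \<open>a * x\<close>.\<close>

lemma integral_multiple:
  obtains a where "a \<in> A" "a \<noteq> 0" "a * x \<in> B"
proof -
  obtain f where f: "f \<in> polys_over K" "Polynomial.lead_coeff f = 1" "poly f x = 0"
    using minimal_poly_ex[of x] by (auto simp: is_minimal_poly_def)
  obtain a where a: "a \<in> A" "a \<noteq> 0" "Polynomial.smult a f \<in> polys_over A"
    using clear_denominators_poly[OF f(1)] by blast
  define n where "n = Polynomial.degree f"
  have n: "n > 0" unfolding n_def using f(2,3) by (rule degree_pos_of_monic_root)
  \<comment> \<open>Below degree \<open>n\<close> this is \<open>a ^ (n - i)\<close> times the
    coefficient of \<open>f\<close>, with one factor \<open>a\<close> kept beside the coefficient to
    show membership in \<open>A\<close>.\<close>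
  define c where "c i = (if i < n then a ^ (n - 1 - i) * (a * Polynomial.coeff f i) else 1)" for i
  have c: "c i \<in> A" for i
    using polys_overD[OF a(3), of i] a(1) by (auto simp: c_def)
  define q where "q = (\<Sum>i\<le>n. Polynomial.monom (c i) i)"
  have coq: "Polynomial.coeff q i = (if i \<le> n then c i else 0)" for i
    by (simp add: q_def Polynomial.coeff_sum)
  have "q \<in> polys_over A" using c by (auto simp: polys_over_def coq)
  moreover have "Polynomial.lead_coeff q = 1"
  proof -
    have "Polynomial.degree q = n"
      by (rule antisym[OF degree_le le_degree]) (auto simp: coq c_def)
    then show ?thesis by (simp add: coq c_def)
  qed
  moreover have "poly q (a * x) = 0"
  proof -
    have "c i * (a * x) ^ i = a ^ n * (Polynomial.coeff f i * x ^ i)" if "i \<le> n" for i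
    proof (cases "i < n")
      case True
      then have "n = (n - 1 - i) + 1 + i" by simp
      then have "a ^ n = a ^ (n - 1 - i) * a * a ^ i" by (metis power_add power_one_right)
      then show ?thesis using True by (simp add: c_def power_mult_distrib)
    next
      case False
      then show ?thesis using that f(2) by (simp add: c_def n_def power_mult_distrib)
    qed
    then have "poly q (a * x) = (\<Sum>i\<le>n. a ^ n * (Polynomial.coeff f i * x ^ i))"
      by (simp add: q_def poly_sum poly_monom)
    also have "\<dots> = a ^ n * poly f x" by (simp add: poly_altdef n_def sum_distrib_left)
    finally show ?thesis using f(3) by simp
  qed
  ultimately have "a * x \<in> B" unfolding integral_closure_def integral_over_def by blast
  then show ?thesis using that a by blast
qed

lemma poly_in_B: "p \<in> polys_over A \<Longrightarrow> x \<in> B \<Longrightarrow> poly p x \<in> B"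
  using polys_over_mono[OF subset_integral_closure] by (intro B.poly_mem) auto

text \<open>In a monic equation of least degree for \<open>e\<close> the constant term is nonzero,
  and \<open>e\<close> divides it in \<open>B\<close>.\<close>

lemma multiple_in_A:
  assumes e: "e \<in> B" "e \<noteq> 0"
  obtains y where "y \<in> B" "e * y \<in> A" "e * y \<noteq> 0"
proof -
  define ok where "ok p \<longleftrightarrow> p \<in> polys_over A \<and> Polynomial.lead_coeff p = 1 \<and> poly p e = 0" for p
  obtain p\<^sub>0 where "ok p\<^sub>0" using e(1) by (auto simp: ok_def integral_closure_def integral_over_def)
  then obtain p where p: "ok p" and min: "\<And>q. ok q \<Longrightarrow> Polynomial.degree p \<le> Polynomial.degree q"
    using exists_least_iff[of "\<lambda>n. \<exists>p. ok p \<and> Polynomial.degree p = n"] by (metis not_less)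
  obtain a q where aq: "p = pCons a q" by (cases p)
  have A: "a \<in> A" "q \<in> polys_over A" using p by (auto simp: ok_def aq polys_pCons_iff)
  have pe: "a + e * poly q e = 0" using p by (simp add: ok_def aq)
  have "a \<noteq> 0"
  proof
    assume "a = 0"
    then have "q \<noteq> 0" using p by (auto simp: ok_def aq)
    then have "ok q" using p A pe \<open>a = 0\<close> e(2) by (simp add: ok_def aq)
    then show False using min[of q] \<open>q \<noteq> 0\<close> by (simp add: aq)
  qed
  moreover have "e * poly q e = - a" using pe by (simp add: eq_neg_iff_add_eq_0 add.commute)
  moreover have "poly q e \<in> B" using A(2) e(1) by (rule poly_in_B)
  ultimately show ?thesis using that[of "poly q e"] A(1) by auto
qed

lemma primitive_integral_element:
  obtains \<alpha> where "\<alpha> \<in> B" "adjoin K \<alpha> = UNIV"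
proof -
  obtain S where S: "finite S" "span_over K S = UNIV" using finite_ext by blast
  have "infinite K" using infinite_A subset_fractions finite_subset by blast
  then obtain \<gamma> where \<gamma>: "S \<subseteq> adjoin K \<gamma>" using K.primitive_element_finite_set[OF _ sep S(1)] by blast
  interpret C: field_subring "adjoin K \<gamma>" by (rule K.field_subring_adjoin)
  have "submodule_over K (adjoin K \<gamma>)" by (rule submodule_antimono[OF C.submodule_self K.adjoin_base])
  then have UN: "adjoin K \<gamma> = UNIV" using span_over_least[OF _ \<gamma>] S(2) by blast
  obtain a where a: "a \<in> A" "a \<noteq> 0" "a * \<gamma> \<in> B" by (rule integral_multiple)
  interpret D: field_subring "adjoin K (a * \<gamma>)" by (rule K.field_subring_adjoin)
  have "inverse a \<in> K" using a subset_fractions by auto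
  then have "inverse a * (a * \<gamma>) \<in> adjoin K (a * \<gamma>)"
    using K.adjoin_base[of "a * \<gamma>"] K.adjoin_gen[of "a * \<gamma>"] by blast
  moreover have "inverse a * (a * \<gamma>) = \<gamma>" using a(2) by (simp flip: mult.assoc)
  ultimately have "adjoin K \<gamma> \<subseteq> adjoin K (a * \<gamma>)"
    using K.adjoin_least[OF D.field_subring_axioms K.adjoin_base] by simp
  then show ?thesis using that a(3) UN by blast
qed

text \<open>With \<open>D\<close> the derivative of the minimal polynomial at \<theta>,
  \<open>deriv_mult_integral\<close> puts \<open>D B\<close> into the span of the powers of
  \<theta>. The factors \<open>a\<close> and \<open>z\<close> replace \<open>D\<close> by a nonzero
  multiple in \<open>A\<close>, which is \<open>d\<close>.\<close>

lemma multiple_in_monogenic_order: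
  assumes \<theta>: "\<theta> \<in> B" "adjoin K \<theta> = UNIV"
  obtains d n where "d \<in> A" "d \<noteq> 0" "\<And>y. y \<in> B \<Longrightarrow> d * y \<in> span_over A ((\<lambda>i. \<theta> ^ i) ` {..<n::nat})"
proof -
  obtain f where f: "is_minimal_poly K \<theta> f" "rsquarefree (map_poly to_ac f)"
    using sep[of \<theta>] by (auto simp: separable_element_def)
  define D where "D = poly (pderiv f) \<theta>"
  have D0: "D \<noteq> 0" unfolding D_def
    by (rule poly_pderiv_nonzero_of_rsquarefree[OF f(2)]) (use f(1) in \<open>auto simp: is_minimal_poly_def\<close>)
  obtain a where a: "a \<in> A" "a \<noteq> 0" "a * D \<in> B" by (rule integral_multiple)
  then obtain z where z: "z \<in> B" "a * D * z \<in> A" "a * D * z \<noteq> 0"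
    using multiple_in_A[of "a * D"] D0 by auto
  have "a * D * z * y \<in> span_over A ((\<lambda>i. \<theta> ^ i) ` {..<Polynomial.degree f})" if "y \<in> B" for y
  proof -
    have "a * z * y \<in> B" using a z that subset_integral_closure by auto
    then have "D * (a * z * y) \<in> span_over A ((\<lambda>i. \<theta> ^ i) ` {..<Polynomial.degree f})"
      using deriv_mult_integral[OF f] \<theta> by (auto simp: D_def integral_closure_def)
    then show ?thesis by (simp add: mult_ac)
  qed
  then show ?thesis using that z by blast
qed

text \<open>For a primitive integral \<alpha>, \<open>B\<close> lies in the module spanned by
  finitely many powers of \<alpha> divided by \<open>d\<close>, and submodules of such a module are
  finitely generated.\<close>

lemma B_finitely_generated:
  obtains W where "finite W" "B = span_over A W"
proof -
  obtain \<alpha> where \<alpha>: "\<alpha> \<in> B" "adjoin K \<alpha> = UNIV" by (rule primitive_integral_element)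
  obtain d n where d: "d \<in> A" "d \<noteq> 0"
    "\<And>y. y \<in> B \<Longrightarrow> d * y \<in> span_over A ((\<lambda>i. \<alpha> ^ i) ` {..<n::nat})"
    using multiple_in_monogenic_order[OF \<alpha>] by blast
  define V where "V = (\<lambda>v. inverse d * v) ` (\<lambda>i. \<alpha> ^ i) ` {..<n}"
  have "y \<in> span_over A V" if "y \<in> B" for y
  proof -
    have "inverse d * (d * y) \<in> span_over A V"
      by (rule span_over_stable[OF _ d(3)[OF that]]) (auto simp: V_def intro!: span_over_base)
    moreover have "inverse d * (d * y) = y" using d(2) by (simp flip: mult.assoc)
    ultimately show ?thesis by simp
  qed
  then have "B \<subseteq> span_over A V" by blast
  moreover have "submodule_over A B" by (rule submodule_antimono[OF B.submodule_self subset_integral_closure])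
  moreover have "finite V" by (simp add: V_def)
  ultimately have "\<exists>W. finite W \<and> B = span_over A W"
    by (intro submodule_finitely_generated[OF noetherian])
  then show ?thesis using that by blast
qed

text \<open>Transitivity of integrality: elements of \<open>B\<close> act on a finite generating set
  of \<open>B\<close> over \<open>A\<close>, so a monic equation over \<open>B\<close> yields a
  finite set stable under \<open>x\<close>.\<close>

lemma integral_over_B:
  assumes "integral_over B x"
  shows "x \<in> B"
proof -
  obtain p where p: "p \<in> polys_over B" "Polynomial.lead_coeff p = 1" "poly p x = 0"
    using assms by (auto simp: integral_over_def)
  obtain V where V: "finite V" "B = span_over A V" by (rule B_finitely_generated)
  have "Polynomial.coeff p i * v \<in> span_over A V" if "v \<in> V" for i v
    using polys_overD[OF p(1), of i] span_over_base[OF that] B.mult_mem unfolding V(2)[symmetric] by blast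
  then obtain W where W: "finite W" "V \<subseteq> W" "\<And>w. w \<in> W \<Longrightarrow> x * w \<in> span_over A W"
    using adjoin_stable[OF V(1) p(2,3)] by metis
  have "1 \<in> span_over A V" using B.one_mem V(2) by simp
  then obtain v where "v \<in> V" "v \<noteq> 0" using span_over_nonzero_generator[OF _ one_neq_zero] by blast
  then have "integral_over A x" using integral_of_stable[OF W(1) _ _ W(3)] W(2) by blast
  then show ?thesis by (simp add: integral_closure_def)
qed

text \<open>A nonzero element of \<open>P\<close> has a nonzero multiple in \<open>A\<close>, so the
  contraction is a nonzero prime of \<open>A\<close>.\<close>

lemma prime_contraction_maximal:
  assumes P: "prime_ideal_of B P" "P \<noteq> {0}"
  shows "maximal_ideal_of A (P \<inter> A)"
proof (rule nonzero_prime_maximal)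
  have mP: "submodule_over B P" "P \<subseteq> B" "1 \<notin> P" using P by (auto simp: prime_ideal_of_def)
  have "submodule_over A P" by (rule submodule_antimono[OF mP(1) subset_integral_closure])
  then have "submodule_over A (P \<inter> A)" using submodule_self by (simp add: submodule_over_def)
  moreover have "x \<in> P \<inter> A \<or> y \<in> P \<inter> A" if "x \<in> A" "y \<in> A" "x * y \<in> P \<inter> A" for x y
    using P(1) that subset_integral_closure unfolding prime_ideal_of_def by blast
  ultimately show "prime_ideal_of A (P \<inter> A)" using mP by (auto simp: prime_ideal_of_def)
  obtain e where e: "e \<in> P" "e \<noteq> 0" using P(2) submodule_zero[OF mP(1)] by blast
  obtain y where y: "y \<in> B" "e * y \<in> A" "e * y \<noteq> 0" using multiple_in_A e mP(2) by blast
  have "e * y \<in> P" using submodule_scale[OF mP(1) y(1) e(1)] by (simp add: mult.commute)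
  then show "P \<inter> A \<noteq> {0}" using y by blast
qed

text \<open>Among the monic polynomials over \<open>A\<close> whose value at \<open>x\<close> lies
  in \<open>P\<close>, one of least degree has its constant term outside \<open>P\<close>. This term
  is invertible modulo \<open>P \<inter> A\<close>, and solving for it inverts \<open>x\<close>
  modulo \<open>P\<close>.\<close>

lemma nonzero_prime_B_maximal:
  assumes P: "prime_ideal_of B P" "P \<noteq> {0}"
  shows "maximal_ideal_of B P"
proof -
  have mP: "submodule_over B P" "P \<subseteq> B" "1 \<notin> P" using P by (auto simp: prime_ideal_of_def)
  have "\<exists>r\<in>B. r * x - 1 \<in> P" if x: "x \<in> B" "x \<notin> P" for x
  proof -
    define ok where "ok p \<longleftrightarrow> p \<in> polys_over A \<and> Polynomial.lead_coeff p = 1 \<and> poly p x \<in> P" for p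
    obtain p\<^sub>0 where "ok p\<^sub>0"
      using x(1) submodule_zero[OF mP(1)] by (fastforce simp: ok_def integral_closure_def integral_over_def)
    then obtain p where p: "ok p" and min: "\<And>q. ok q \<Longrightarrow> Polynomial.degree p \<le> Polynomial.degree q"
      using exists_least_iff[of "\<lambda>n. \<exists>p. ok p \<and> Polynomial.degree p = n"] by (metis not_less)
    obtain a q where aq: "p = pCons a q" by (cases p)
    have A: "a \<in> A" "q \<in> polys_over A" using p by (auto simp: ok_def aq polys_pCons_iff)
    have qB: "poly q x \<in> B" using A(2) x(1) by (rule poly_in_B)
    have pe: "a + x * poly q x \<in> P" using p by (simp add: ok_def aq)
    have "a \<notin> P"
    proof
      assume aP: "a \<in> P"
      then have "q \<noteq> 0" using p mP(3) by (auto simp: ok_def aq)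
      have "(a + x * poly q x) - a \<in> P" by (rule B.submodule_diff[OF mP(1) pe aP])
      then have "x * poly q x \<in> P" by simp
      then have "poly q x \<in> P" using P(1) x qB unfolding prime_ideal_of_def by blast
      then have "ok q" using p A \<open>q \<noteq> 0\<close> by (simp add: ok_def aq)
      then show False using min[of q] \<open>q \<noteq> 0\<close> by (simp add: aq)
    qed
    then obtain r where r: "r \<in> A" "r * a - 1 \<in> P"
      using maximal_ideal_inverse[OF prime_contraction_maximal[OF P], of a] A(1) by blast
    have rB: "r \<in> B" using r subset_integral_closure by blast
    have "(r * a - 1) - r * (a + x * poly q x) \<in> P"
      by (rule B.submodule_diff[OF mP(1) r(2) submodule_scale[OF mP(1) rB pe]])
    moreover have "(r * a - 1) - r * (a + x * poly q x) = - (r * poly q x) * x - 1"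
      by (simp add: algebra_simps)
    ultimately have "- (r * poly q x) * x - 1 \<in> P" by (simp only:)
    moreover have "- (r * poly q x) \<in> B" using rB qB by blast
    ultimately show ?thesis by blast
  qed
  then show ?thesis using mP by (auto simp: maximal_ideal_of_def)
qed

lemma dedekind_ring_B: "dedekind_ring B"
proof
  fix x assume "integral_over B x"
  then show "x \<in> B" by (rule integral_over_B)
next
  fix I assume I: "submodule_over B I" "I \<subseteq> B"
  obtain W where W: "finite W" "B = span_over A W" by (rule B_finitely_generated)
  \<comment> \<open>An ideal of \<open>B\<close> is an \<open>A\<close>-submodule of a finitely
    generated module; its generators over \<open>A\<close> also generate it over
    \<open>B\<close>.\<close>
  have "\<exists>S. finite S \<and> I = span_over A S"
    by (rule submodule_finitely_generated[OF noetherian W(1) submodule_antimono[OF I(1) subset_integral_closure]])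
       (use I(2) W(2) in auto)
  then obtain S where S: "finite S" "I = span_over A S" by blast
  have "S \<subseteq> I" using S(2) span_over_base by blast
  then have "span_over B S \<subseteq> I" by (rule span_over_least[OF I(1)])
  moreover have "submodule_over A (span_over B S)" by (rule submodule_antimono[OF B.submodule_span_over subset_integral_closure])
  then have "span_over A S \<subseteq> span_over B S" by (rule span_over_least) (auto intro: B.span_over_base)
  ultimately show "\<exists>S. finite S \<and> I = span_over B S" using S by blast
qed (rule nonzero_prime_B_maximal)

sublocale B: dedekind_ring "integral_closure A" by (rule dedekind_ring_B)

text \<open>Only finitely many translates of \<beta> by multiples of \<alpha> fail to be primitive,
  while \<open>k\<close> has infinitely many multiples in \<open>A\<close>. The factor
  \<open>k\<close> keeps the translation small modulo a prescribed element.\<close>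

lemma primitive_translate:
  assumes \<alpha>: "adjoin K \<alpha> = UNIV" and k: "k \<in> A" "k \<noteq> 0"
  obtains u where "u \<in> A" "adjoin K (\<beta> + (k * u) * \<alpha>) = UNIV"
proof -
  obtain T where T: "finite T"
    "\<And>z. z \<in> K \<Longrightarrow> z \<notin> T \<Longrightarrow> \<alpha> \<in> adjoin K (\<beta> + z * \<alpha>) \<and> \<beta> \<in> adjoin K (\<beta> + z * \<alpha>)"
    by (rule K.primitive_element_pair[OF minimal_poly_ex sep]) (rule that)
  have "inj_on (\<lambda>u. k * u) A" using k(2) by (auto simp: inj_on_def)
  then have "infinite ((\<lambda>u. k * u) ` A)" using infinite_A finite_imageD by blast
  then have "\<not> (\<lambda>u. k * u) ` A \<subseteq> T" using T(1) finite_subset by blast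
  then obtain u where u: "u \<in> A" "k * u \<notin> T" by blast
  have "k * u \<in> K" using k(1) u(1) subset_fractions by blast
  then have "\<alpha> \<in> adjoin K (\<beta> + (k * u) * \<alpha>)" using T(2) u(2) by blast
  then have "adjoin K (\<beta> + (k * u) * \<alpha>) = UNIV"
    using K.adjoin_least[OF K.field_subring_adjoin K.adjoin_base, of \<alpha>] \<alpha> by blast
  then show ?thesis using that u(1) by blast
qed

text \<open>
  For \<open>s\<close> one takes the product of the differences of \<open>n + 1\<close> elements: modulo a prime not containing
  it, these elements stay distinct, too many to be all roots of a monic polynomial of degree \<open>n\<close>.
\<close>

lemma large_residue_field_element:
  obtains s where "s \<in> A" "s \<noteq> 0"
    "\<And>q f. maximal_ideal_of A q \<Longrightarrow> s \<notin> q \<Longrightarrow> f \<in> polys_over A \<Longrightarrow> Polynomial.lead_coeff f = 1 \<Longrightarrow>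
      Polynomial.degree f = n \<Longrightarrow> \<exists>a\<in>A. poly f a \<notin> q"
proof -
  obtain T where T: "T \<subseteq> A" "finite T" "card T = Suc n"
    using infinite_arbitrarily_large[OF infinite_A] by blast
  define D where "D = {(x, y). x \<in> T \<and> y \<in> T \<and> x \<noteq> y}"
  define s where "s = (\<Prod>p\<in>D. fst p - snd p)"
  have fin: "finite D" unfolding D_def
    by (rule finite_subset[of _ "T \<times> T"]) (use T(2) in auto)
  have DA: "fst p - snd p \<in> A" if "p \<in> D" for p using subsetD[OF T(1)] that by (auto simp: D_def)
  show ?thesis
  proof (rule that[of s])
    show "s \<in> A" unfolding s_def using DA by (rule prod_mem)
    show "s \<noteq> 0" unfolding s_def using fin by (auto simp: prod_zero_iff D_def)
  next
    fix q f assume q: "maximal_ideal_of A q" "s \<notin> q" and f: "f \<in> polys_over A" "Polynomial.lead_coeff f = 1" "Polynomial.degree f = n"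
    have mq: "submodule_over A q" using q(1) by (simp add: maximal_ideal_of_def)
    have "x - y \<notin> q" if xy: "x \<in> T" "y \<in> T" "x \<noteq> y" for x y
    proof
      assume dq: "x - y \<in> q"
      have "(x, y) \<in> D" using xy by (simp add: D_def)
      then have "s = (x - y) * (\<Prod>p\<in>D - {(x, y)}. fst p - snd p)"
        unfolding s_def using fin by (simp add: prod.remove)
      moreover have "(\<Prod>p\<in>D - {(x, y)}. fst p - snd p) \<in> A"
        using DA by (intro prod_mem) blast
      ultimately have "s \<in> q" using submodule_scale[OF mq _ dq] by (metis mult.commute)
      with q(2) show False by blast
    qed
    then have "\<exists>a\<in>T. poly f a \<notin> q"
      using monic_poly_nonzero_mod_prime[OF maximal_ideal_imp_prime[OF q(1)] f(1,2) T(1)] T(3) f(3) by auto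
    then show "\<exists>a\<in>A. poly f a \<notin> q" using T(1) by blast
  qed
qed

section \<open>Multiples of degree one\<close>

lemma degree_one_multiple_of_unital:
  assumes J: "submodule_over B J" "1 \<in> J" and e: "e \<noteq> 0" "\<And>j. j \<in> J \<Longrightarrow> e * j \<in> B"
  obtains x where "x \<noteq> 0" "\<And>j. j \<in> J \<Longrightarrow> x * j \<in> B"
    "\<And>y. y \<in> B \<Longrightarrow> \<exists>a\<in>A. \<exists>j\<in>J. y = a + x * j"
proof -
  have AB: "z \<in> B" if "z \<in> A" for z using that subset_integral_closure by blast
  have BJ: "b \<in> J" if "b \<in> B" for b using submodule_scale[OF J(1) that J(2)] by simp
  obtain y where y: "y \<in> B" "e * y \<in> A" "e * y \<noteq> 0"
    using multiple_in_A[of e] e(1) e(2)[OF J(2)] by auto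
  \<comment> \<open>A common denominator of \<open>J\<close> that lies in \<open>A\<close>.\<close>
  define c where "c = e * y"
  have c: "c \<in> A" "c \<noteq> 0" using y by (simp_all add: c_def)
  have cJ: "c * j \<in> B" if "j \<in> J" for j
    using B.mult_mem[OF y(1) e(2)[OF that]] by (simp add: c_def mult_ac)
  obtain \<alpha> where \<alpha>: "\<alpha> \<in> B" "adjoin K \<alpha> = UNIV" by (rule primitive_integral_element)
  obtain W where W: "finite W" "B = span_over A W" by (rule B_finitely_generated)
  have "1 \<in> span_over A W" using B.one_mem W(2) by simp
  then obtain w where w: "w \<in> W" "w \<noteq> 0" using span_over_nonzero_generator[OF _ one_neq_zero] by blast
  obtain s where s: "s \<in> A" "s \<noteq> 0" and sq: "\<And>q f. maximal_ideal_of A q \<Longrightarrow> s \<notin> q \<Longrightarrow> f \<in> polys_over A \<Longrightarrow>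
      Polynomial.lead_coeff f = 1 \<Longrightarrow> Polynomial.degree f = card W \<Longrightarrow> \<exists>a\<in>A. poly f a \<notin> q"
    by (rule large_residue_field_element[of "card W"]) (rule that)
  \<comment> \<open>Primes outside \<open>m\<close> have large residue fields because of \<open>s\<close>; the nonunit \<open>t\<close> ensures \<open>x \<noteq> 0\<close> below.\<close>
  define m where "m = c * s * t"
  have m: "m \<in> A" "m \<noteq> 0" using c s t by (auto simp: m_def)
  \<comment> \<open>An inverse of \<open>m\<close> in \<open>B\<close> would lie in
    \<open>K\<close>, hence in \<open>A\<close> by integral closedness, and would make
    \<open>t\<close> a unit of \<open>A\<close>.\<close>
  have m_inv: "1 \<noteq> b * m" if "b \<in> B" for b
  proof
    assume "1 = b * m"
    then have bm: "b = inverse m" using m(2) by (simp add: field_simps)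
    have "inverse m \<in> K" using m subset_fractions by blast
    then have "b \<in> A" using that bm by (auto simp: integral_closure_def intro: int_closed)
    then have "(c * s) * b \<in> A" using c s by blast
    moreover have "(c * s) * b = inverse t" using bm c(2) s(2) t(2) by (simp add: m_def field_simps)
    ultimately show False using t(3) by simp
  qed
  have J0: "J \<noteq> {0}" using J(2) by auto
  obtain \<theta>\<^sub>0 j\<^sub>0 b\<^sub>0 where \<theta>\<^sub>0: "\<And>j. j \<in> J \<Longrightarrow> \<theta>\<^sub>0 * j \<in> B" "j\<^sub>0 \<in> J" "b\<^sub>0 \<in> B" "\<theta>\<^sub>0 * j\<^sub>0 + b\<^sub>0 * m = 1"
    by (rule B.fractional_ideal_local_generator[OF J(1) J0 e AB[OF m(1)] m(2)]) (assumption | rule that)+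
  have \<theta>\<^sub>0B: "\<theta>\<^sub>0 \<in> B" using \<theta>\<^sub>0(1)[OF J(2)] by simp
  have cm: "c * m \<in> A" "c * m \<noteq> 0" using c m by auto
  \<comment> \<open>Translating by multiples of \<open>c * m\<close> changes the products with
    elements of \<open>J\<close> only by elements of \<open>m B\<close>, because \<open>c J\<close>
    lies in \<open>B\<close>.\<close>
  obtain u where u: "u \<in> A" "adjoin K (\<theta>\<^sub>0 + (c * m * u) * \<alpha>) = UNIV"
    by (rule primitive_translate[OF \<alpha>(2) cm]) (rule that)
  define \<theta> where "\<theta> = \<theta>\<^sub>0 + (c * m * u) * \<alpha>"
  have \<theta>B: "\<theta> \<in> B" using AB cm(1) u(1) \<theta>\<^sub>0B \<alpha>(1) unfolding \<theta>_def by blast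
  have "adjoin K \<theta> = UNIV" using u(2) by (simp only: \<theta>_def)
  then obtain d n where d: "d \<in> A" "d \<noteq> 0"
    "\<And>y. y \<in> B \<Longrightarrow> d * y \<in> span_over A ((\<lambda>i. \<theta> ^ i) ` {..<n::nat})"
    using multiple_in_monogenic_order[OF \<theta>B] by blast
  have "\<theta> * v \<in> span_over A W" if "v \<in> W" for v
    using B.mult_mem[OF \<theta>B] span_over_base[OF that] unfolding W(2)[symmetric] by blast
  \<comment> \<open>The degree is the size of \<open>W\<close>, fixed before \<theta> was chosen;
    this is the degree for which \<open>s\<close> was constructed.\<close>
  then obtain f where f: "f \<in> polys_over A" "Polynomial.lead_coeff f = 1"
    "Polynomial.degree f = card W" "poly f \<theta> = 0"
    using monic_of_stable_span[OF W(1) w] by blast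
  \<comment> \<open>The primes of \<open>A\<close> below which coprimality to \<open>d\<close> is
    not yet ensured by coprimality to \<open>m\<close>.\<close>
  define Q where "Q = {q. maximal_ideal_of A q \<and> d \<in> q} \<inter> {q. m \<notin> q}"
  have finQ: "finite Q" unfolding Q_def using finite_maximal_ideals_containing[OF d(1,2)] by blast
  have Q: "maximal_ideal_of A q" "submodule_over A q" "m \<notin> q" "prime_ideal_of A q" if "q \<in> Q" for q
    using that maximal_ideal_imp_prime by (auto simp: Q_def maximal_ideal_of_def)
  \<comment> \<open>A prime not containing \<open>m\<close> contains none of its factors:
    \<open>s\<close> outside \<open>q\<close> gives a nonroot of \<open>f\<close> modulo
    \<open>q\<close>, and \<open>c\<close> and \<open>m\<close> outside \<open>q\<close> make their
    product invertible there.\<close>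
  have avoid: "- (c * m) \<notin> q \<and> (\<exists>z\<in>A. poly f z \<notin> q)" if q: "q \<in> Q" for q
  proof -
    note mq = Q(2)[OF q]
    have factor: "a \<notin> q" if "b \<in> A" "b * a = m" for a b
      using submodule_scale[OF mq that(1)] that(2) Q(3)[OF q] by blast
    have "s \<notin> q" using c(1) t(1) by (intro factor[of "c * t"]) (auto simp: m_def mult_ac)
    then have "\<exists>z\<in>A. poly f z \<notin> q" using sq[OF Q(1)[OF q] _ f(1-3)] by blast
    moreover have "c \<notin> q" using s(1) t(1) by (intro factor[of "s * t"]) (auto simp: m_def mult_ac)
    then have "c * m \<notin> q" using Q(3,4)[OF q] c(1) m(1) unfolding prime_ideal_of_def by blast
    then have "- (c * m) \<notin> q" using submodule_uminus[OF mq, of "- (c * m)"] by auto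
    ultimately show ?thesis by blast
  qed
  obtain a' where a': "a' \<in> A" "\<And>q. q \<in> Q \<Longrightarrow> poly f (- (c * m) * a') \<notin> q"
    by (rule avoid_roots_mod_maximal_ideals[OF f(1) uminus_mem[OF cm(1)] finQ Q(1)])
       (use avoid that in blast)+
  \<comment> \<open>The sign makes \<open>x\<close> equal to \<open>\<theta>\<^sub>0\<close> plus
    \<open>c * m\<close> times an element of \<open>B\<close>.\<close>
  define a\<^sub>0 where "a\<^sub>0 = - (c * m) * a'"
  have a\<^sub>0: "a\<^sub>0 \<in> A" unfolding a\<^sub>0_def using cm(1) a'(1) by blast
  have fa\<^sub>0: "poly f a\<^sub>0 \<notin> q" if "q \<in> Q" for q unfolding a\<^sub>0_def using that by (rule a'(2))
  define x where "x = \<theta> - a\<^sub>0"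
  have x_eq: "x * j = \<theta>\<^sub>0 * j + (m * (u * \<alpha> + a')) * (c * j)" for j
    by (simp add: x_def \<theta>_def a\<^sub>0_def algebra_simps)
  have mB: "m * (u * \<alpha> + a') \<in> B" using AB m(1) u(1) a'(1) \<alpha>(1) by blast
  have xJ: "x * j \<in> B" if "j \<in> J" for j
    unfolding x_eq by (rule B.add_mem[OF \<theta>\<^sub>0(1)[OF that] B.mult_mem[OF mB cJ[OF that]]])
  \<comment> \<open>The correction in \<open>m B\<close> is absorbed into the coefficient of
    \<open>m\<close>, so \<open>x J\<close> is still coprime to \<open>m\<close>.\<close>
  have xm: "x * j\<^sub>0 + (b\<^sub>0 - (u * \<alpha> + a') * (c * j\<^sub>0)) * m = 1"
    unfolding x_eq using \<theta>\<^sub>0(4) by (simp add: algebra_simps)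
  have xmB: "b\<^sub>0 - (u * \<alpha> + a') * (c * j\<^sub>0) \<in> B"
    using \<theta>\<^sub>0(3) cJ[OF \<theta>\<^sub>0(2)] AB u(1) a'(1) \<alpha>(1) by blast
  have x0: "x \<noteq> 0" using m_inv[OF xmB] xm by auto
  have mxJ: "submodule_over B ((\<lambda>j. x * j) ` J)" using J(1) by (rule submodule_image_mult)
  define I where "I = {i + r * d | i r. i \<in> (\<lambda>j. x * j) ` J \<and> r \<in> B}"
  have I: "submodule_over B I" unfolding I_def using mxJ by (rule B.submodule_add_principal)
  have xI: "x * j \<in> I" if "j \<in> J" for j
    using B.subset_add_principal[of "(\<lambda>j. x * j) ` J" d] that unfolding I_def by blast
  have IB: "I \<subseteq> B" unfolding I_def using xJ AB[OF d(1)] by blast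
  \<comment> \<open>A maximal ideal \<open>M\<close> containing \<open>x J\<close> and
    \<open>d\<close> cannot contain \<open>m\<close>, so it lies over a prime in \<open>Q\<close>.
    Since \<open>x\<close> belongs to \<open>M\<close>, the value of \<open>f\<close> at
    \<open>a\<^sub>0\<close> is congruent to its value 0 at \<theta>, against the choice of
    \<open>a\<^sub>0\<close>.\<close>
  have "1 \<in> I"
  proof (rule ccontr)
    assume "1 \<notin> I"
    then obtain M where M: "maximal_ideal_of B M" "I \<subseteq> M" by (rule B.maximal_ideal_containing[OF I IB])
    have rM: "submodule_over B M" "1 \<notin> M" using M(1) by (auto simp: maximal_ideal_of_def)
    have "d \<in> I" unfolding I_def using mxJ by (rule B.mem_add_principal)
    then have dM: "d \<in> M" using M(2) by blast
    then have "M \<noteq> {0}" using d(2) by blast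
    then have q: "maximal_ideal_of A (M \<inter> A)" by (rule prime_contraction_maximal[OF B.maximal_ideal_imp_prime[OF M(1)]])
    have "m \<notin> M"
    proof
      assume "m \<in> M"
      then have "x * j\<^sub>0 + (b\<^sub>0 - (u * \<alpha> + a') * (c * j\<^sub>0)) * m \<in> M"
        using xI[OF \<theta>\<^sub>0(2)] M(2) by (intro submodule_add[OF rM(1)] submodule_scale[OF rM(1) xmB]) blast
      then show False using xm rM(2) by simp
    qed
    then have "M \<inter> A \<in> Q" using q dM d(1) by (simp add: Q_def)
    then have "poly f a\<^sub>0 \<notin> M \<inter> A" by (rule fa\<^sub>0)
    moreover have "poly f a\<^sub>0 \<in> A" using f(1) a\<^sub>0 by (rule poly_mem)
    moreover have "poly f \<theta> - poly f a\<^sub>0 \<in> M"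
    proof (rule B.poly_cong[OF _ rM(1) \<theta>B AB[OF a\<^sub>0]])
      show "f \<in> polys_over B" using f(1) polys_over_mono[OF subset_integral_closure] by blast
      show "\<theta> - a\<^sub>0 \<in> M" using xI[OF J(2)] M(2) by (auto simp: x_def)
    qed
    then have "poly f a\<^sub>0 \<in> M" using B.submodule_uminus[OF rM(1), of "poly f \<theta> - poly f a\<^sub>0"] f(4) by simp
    ultimately show False by blast
  qed
  then obtain j\<^sub>1 r where j\<^sub>1: "j\<^sub>1 \<in> J" "r \<in> B" "1 = x * j\<^sub>1 + r * d" by (auto simp: I_def)
  \<comment> \<open>Since \<theta> is congruent to \<open>a\<^sub>0\<close> modulo \<open>x\<close>,
    a polynomial in \<theta> over \<open>A\<close> differs from its value at
    \<open>a\<^sub>0\<close> by an element of \<open>x B\<close>.\<close>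
  have split: "\<exists>a\<in>A. \<exists>b\<in>B. v = a + x * b" if "v \<in> span_over A ((\<lambda>i. \<theta> ^ i) ` {..<n})" for v
  proof -
    have "\<theta> ^ i \<in> adjoin A \<theta>" for i
      using field_subring.power_mem[OF field_subring_adjoin adjoin_gen] .
    moreover have "submodule_over A (adjoin A \<theta>)"
      by (rule submodule_antimono[OF field_subring.submodule_self[OF field_subring_adjoin] adjoin_base])
    ultimately have "v \<in> adjoin A \<theta>" using span_over_least[of A "adjoin A \<theta>"] that by blast
    then obtain p where p: "p \<in> polys_over A" "v = poly p \<theta>" by (auto simp: adjoin_def)
    have "poly p \<theta> - poly p a\<^sub>0 \<in> {b * x | b. b \<in> B}"
    proof (rule B.poly_cong[OF _ B.submodule_principal \<theta>B AB[OF a\<^sub>0]])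
      show "p \<in> polys_over B" using p(1) polys_over_mono[OF subset_integral_closure] by blast
      show "\<theta> - a\<^sub>0 \<in> {b * x | b. b \<in> B}" by (auto simp: x_def intro!: exI[of _ 1])
    qed
    then obtain b where b: "b \<in> B" "poly p \<theta> - poly p a\<^sub>0 = b * x" by blast
    have "v = poly p a\<^sub>0 + x * b" using b(2) p(2) by (simp add: algebra_simps)
    then show ?thesis using b(1) poly_mem[OF p(1) a\<^sub>0] by blast
  qed
  have "\<exists>a\<in>A. \<exists>j\<in>J. y = a + x * j" if y: "y \<in> B" for y
  proof -
    have "r * y \<in> B" using j\<^sub>1 y by blast
    then obtain a b where ab: "a \<in> A" "b \<in> B" "d * (r * y) = a + x * b" using split[OF d(3)] by blast
    \<comment> \<open>The first summand lands in \<open>x J\<close>, the second in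
      \<open>d B\<close>, hence in \<open>A + x B\<close>; and \<open>B\<close> is contained in
      \<open>J\<close>.\<close>
    have "y = y * (x * j\<^sub>1 + r * d)" using j\<^sub>1(3) by simp
    also have "\<dots> = x * (y * j\<^sub>1) + d * (r * y)" by (simp add: algebra_simps)
    also have "\<dots> = a + x * (y * j\<^sub>1 + b)" unfolding ab(3) by (simp add: algebra_simps)
    finally have "y = a + x * (y * j\<^sub>1 + b)" .
    moreover have "y * j\<^sub>1 + b \<in> J" by (rule submodule_add[OF J(1) submodule_scale[OF J(1) y j\<^sub>1(1)] BJ[OF ab(2)]])
    ultimately show ?thesis using ab(1) by blast
  qed
  then show ?thesis using that x0 xJ by blast
qed

text \<open>Division by a nonzero \<open>k\<close> from \<open>J\<close> gives a module containing
  1, and a multiplier \<open>x\<close> for it yields the multiplier \<open>x / k\<close> for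
  \<open>J\<close>.\<close>

lemma degree_one_multiple:
  assumes J: "submodule_over B J" "J \<noteq> {0}" and e: "e \<noteq> 0" "\<And>j. j \<in> J \<Longrightarrow> e * j \<in> B"
  obtains x where "x \<noteq> 0" "\<And>j. j \<in> J \<Longrightarrow> x * j \<in> B"
    "\<And>y. y \<in> B \<Longrightarrow> \<exists>a\<in>A. \<exists>j\<in>J. y = a + x * j"
proof -
  obtain k where k: "k \<in> J" "k \<noteq> 0" using J submodule_zero by blast
  define J' where "J' = {j. k * j \<in> J}"
  have J': "submodule_over B J'"
  proof (rule submodule_overI)
    show "0 \<in> J'" using submodule_zero[OF J(1)] by (simp add: J'_def)
    show "x + y \<in> J'" if "x \<in> J'" "y \<in> J'" for x y
      using that submodule_add[OF J(1)] by (simp add: J'_def distrib_left)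
    show "r * x \<in> J'" if "r \<in> B" "x \<in> J'" for r x
    proof -
      have "r * (k * x) \<in> J" using that submodule_scale[OF J(1)] by (simp add: J'_def)
      moreover have "r * (k * x) = k * (r * x)" by (simp add: mult_ac)
      ultimately show ?thesis by (simp add: J'_def)
    qed
  qed
  have "1 \<in> J'" using k by (simp add: J'_def)
  moreover have "e * k \<noteq> 0" using e k by simp
  moreover have "\<And>j. j \<in> J' \<Longrightarrow> e * k * j \<in> B" using e(2) by (simp add: J'_def mult.assoc)
  ultimately obtain x where x: "x \<noteq> 0" "\<And>j. j \<in> J' \<Longrightarrow> x * j \<in> B"
    "\<And>y. y \<in> B \<Longrightarrow> \<exists>a\<in>A. \<exists>j\<in>J'. y = a + x * j"
    using degree_one_multiple_of_unital[OF J'] by metis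
  have kj: "j / k \<in> J'" if "j \<in> J" for j using that k by (simp add: J'_def)
  show ?thesis
  proof (rule that[of "x / k"])
    show "x / k \<noteq> 0" using x k by simp
    show "x / k * j \<in> B" if "j \<in> J" for j using x(2)[OF kj[OF that]] by simp
    fix y assume "y \<in> B"
    then obtain a j where "a \<in> A" "j \<in> J'" "y = a + x * j" using x(3) by blast
    then show "\<exists>a\<in>A. \<exists>j\<in>J. y = a + x / k * j"
      using k by (intro bexI[of _ a] bexI[of _ "k * j"]) (auto simp: J'_def)
  qed
qed

end

section \<open>The ideal class group\<close>

lemma ambient_sel [simp]:
  "carrier ambient = UNIV" "x \<otimes>\<^bsub>ambient\<^esub> y = x * y" "x \<oplus>\<^bsub>ambient\<^esub> y = x + y"
  "\<one>\<^bsub>ambient\<^esub> = 1" "\<zero>\<^bsub>ambient\<^esub> = 0"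
  by (simp_all add: ring_of_type_algebra_def)

lemma ambient_a_inv [simp]: "\<ominus>\<^bsub>ambient\<^esub> x = - (x::'a::field)"
proof -
  interpret ring "ambient :: 'a ring" by (rule ring_from_type_algebra)
  have "- x \<oplus>\<^bsub>ambient\<^esub> x = \<zero>\<^bsub>ambient\<^esub>" by simp
  then show ?thesis by (rule minus_equality) simp_all
qed

lemma ring_on_sel [simp]:
  "carrier (ring_on R) = R" "x \<otimes>\<^bsub>ring_on R\<^esub> y = x * y" "x \<oplus>\<^bsub>ring_on R\<^esub> y = x + y"
  "\<one>\<^bsub>ring_on R\<^esub> = 1" "\<zero>\<^bsub>ring_on R\<^esub> = 0"
  by (simp_all add: ring_on_def)

lemma field_subring_of_subring:
  assumes "subring R (ambient :: 'a::field ring)"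
  shows "field_subring R"
proof
  show "1 \<in> R" using subringE(3)[OF assms] by simp
next
  fix x y assume xy: "x \<in> R" "y \<in> R"
  then show "x * y \<in> R" using subringE(6)[OF assms] by simp
  have "- y \<in> R" using subringE(5)[OF assms xy(2)] by simp
  then show "x - y \<in> R" using subringE(7)[OF assms xy(1), of "- y"] by simp
qed

context field_subring
begin

lemma cring_ring_on: "cring (ring_on R)"
proof -
  have "ring (ring_on R)"
    unfolding ring_on_def
  proof (rule ring.subring_is_ring[OF ring_from_type_algebra])
    show "subring R ambient"
      by (rule ring.subringI[OF ring_from_type_algebra]) auto
  qed
  then show ?thesis
    by (auto simp: cring_def comm_monoid_def comm_monoid_axioms_def ring_def)
qed

lemma ideal_ring_on_iff: "ideal I (ring_on R) \<longleftrightarrow> submodule_over R I \<and> I \<subseteq> R"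
proof
  assume I: "ideal I (ring_on R)"
  interpret ideal I "ring_on R" by fact
  have "submodule_over R I"
    using additive_subgroup.zero_closed[OF is_additive_subgroup]
      additive_subgroup.a_closed[OF is_additive_subgroup] I_l_closed by (intro submodule_overI) auto
  then show "submodule_over R I \<and> I \<subseteq> R" using a_subset by simp
next
  assume I: "submodule_over R I \<and> I \<subseteq> R"
  interpret cring "ring_on R" by (rule cring_ring_on)
  show "ideal I (ring_on R)"
  proof (rule idealI[OF ring_axioms])
    show "subgroup I (add_monoid (ring_on R))"
    proof (rule add.subgroupI)
      show "I \<noteq> {}" using I submodule_zero by blast
      fix a assume a: "a \<in> I"
      then have "\<ominus>\<^bsub>ring_on R\<^esub> a = - a"
        using I by (intro minus_equality) auto
      then show "\<ominus>\<^bsub>ring_on R\<^esub> a \<in> I" using submodule_uminus a I by simp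
    qed (use I submodule_add in auto)
  next
    fix a x assume "a \<in> I" "x \<in> carrier (ring_on R)"
    then have "x * a \<in> I" using I submodule_scale[of R I x a] by simp
    then show "x \<otimes>\<^bsub>ring_on R\<^esub> a \<in> I" "a \<otimes>\<^bsub>ring_on R\<^esub> x \<in> I" by (simp_all add: mult.commute)
  qed
qed

lemma genideal_ring_on:
  assumes "S \<subseteq> R"
  shows "Idl\<^bsub>ring_on R\<^esub> S = span_over R S"
proof
  have "span_over R S \<subseteq> R" by (rule span_over_least[OF submodule_self assms])
  then have "ideal (span_over R S) (ring_on R)" by (simp add: ideal_ring_on_iff submodule_span_over)
  moreover have "S \<subseteq> span_over R S" using span_over_base by blast
  ultimately show "Idl\<^bsub>ring_on R\<^esub> S \<subseteq> span_over R S" unfolding genideal_def by blast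
  show "span_over R S \<subseteq> Idl\<^bsub>ring_on R\<^esub> S"
    unfolding genideal_def by (auto simp: ideal_ring_on_iff dest: span_over_least)
qed

lemma primeideal_ring_on: "prime_ideal_of R P \<Longrightarrow> primeideal P (ring_on R)"
proof -
  assume P: "prime_ideal_of R P"
  show ?thesis
  proof (rule primeideal.intro)
    show "ideal P (ring_on R)" using P by (simp add: ideal_ring_on_iff prime_ideal_of_def)
    show "cring (ring_on R)" by (rule cring_ring_on)
    show "primeideal_axioms P (ring_on R)"
      by (rule primeideal_axioms.intro) (use P in \<open>auto simp: prime_ideal_of_def\<close>)
  qed
qed

text \<open>For \<open>x\<close> outside \<open>M\<close>, maximality among ideals forces
  \<open>M + R x\<close> to be all of \<open>R\<close>; writing 1 in this form inverts
  \<open>x\<close> modulo \<open>M\<close>.\<close>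

lemma maximal_ideal_of_maximalideal:
  assumes "maximalideal M (ring_on R)"
  shows "maximal_ideal_of R M"
proof -
  interpret maximalideal M "ring_on R" by fact
  have M: "submodule_over R M" "M \<subseteq> R" using is_ideal by (simp_all add: ideal_ring_on_iff)
  have one: "1 \<notin> M"
  proof
    assume "1 \<in> M"
    then have "r \<in> M" if "r \<in> R" for r using submodule_scale[OF M(1) that] by force
    then have "R = M" using M(2) by blast
    then show False using I_notcarr by simp
  qed
  have "\<exists>r\<in>R. r * x - 1 \<in> M" if x: "x \<in> R" "x \<notin> M" for x
  proof -
    define J where "J = {i + r * x | i r. i \<in> M \<and> r \<in> R}"
    have "submodule_over R J" unfolding J_def using M(1) by (rule submodule_add_principal)
    moreover have JR: "J \<subseteq> R" using M x by (auto simp: J_def)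
    ultimately have "ideal J (ring_on R)" by (simp add: ideal_ring_on_iff)
    moreover have "M \<subseteq> J" unfolding J_def by (rule subset_add_principal)
    moreover have "x \<in> J" unfolding J_def using M(1) by (rule mem_add_principal)
    ultimately have "J = R" using I_maximal[of J] JR x by auto
    then have "1 \<in> J" by simp
    then obtain i r where ir: "1 = i + r * x" "i \<in> M" "r \<in> R" by (auto simp: J_def)
    have "r * x - 1 = - i" using ir(1) by (simp add: algebra_simps)
    then show ?thesis using ir submodule_uminus[OF M(1)] by metis
  qed
  then show ?thesis using M one by (auto simp: maximal_ideal_of_def)
qed

lemma field_ring_on:
  assumes "\<And>x. x \<in> R \<Longrightarrow> x \<noteq> 0 \<Longrightarrow> inverse x \<in> R"
  shows "Ring.field (ring_on R)"
proof -
  interpret cring "ring_on R" by (rule cring_ring_on)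
  have "x \<in> Units (ring_on R)" if "x \<in> R" "x \<noteq> 0" for x
    using that assms[OF that] by (auto simp: Units_def intro!: bexI[of _ "inverse x"])
  moreover have "0 \<notin> Units (ring_on R)" by (auto simp: Units_def)
  moreover have "Units (ring_on R) \<subseteq> R" by (auto simp: Units_def)
  ultimately show ?thesis by (intro cring_fieldI) auto
qed

end

lemma dedekind_ring_of_dedekind_domain:
  assumes "dedekind_domain R"
  shows "dedekind_ring R"
proof -
  have sr: "subring R ambient" and noeth: "noetherian_domain (ring_on R)"
    and int: "\<forall>x\<in>fractions R. integral_over R x \<longrightarrow> x \<in> R"
    and prime: "\<forall>P. primeideal P (ring_on R) \<and> P \<noteq> {0} \<longrightarrow> maximalideal P (ring_on R)"
    using assms by (auto simp: dedekind_domain_def)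
  interpret field_subring R using sr by (rule field_subring_of_subring)
  interpret N: noetherian_domain "ring_on R" by fact
  show ?thesis
  proof
    fix x assume "x \<in> fractions R" "integral_over R x"
    then show "x \<in> R" using int by blast
  next
    fix I assume "submodule_over R I" "I \<subseteq> R"
    then have "ideal I (ring_on R)" by (simp add: ideal_ring_on_iff)
    then obtain S where "S \<subseteq> R" "finite S" "I = Idl\<^bsub>ring_on R\<^esub> S"
      using N.finetely_gen[of I] by auto
    then show "\<exists>S. finite S \<and> I = span_over R S" using genideal_ring_on by auto
  next
    fix P assume "prime_ideal_of R P" "P \<noteq> {0}"
    then show "maximal_ideal_of R P" using prime primeideal_ring_on maximal_ideal_of_maximalideal by blast
  qed
qed

text \<open>Turns the list-based bases of finite-dimensional spaces into generating sets: once the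
  left side is the whole field, so is the right.\<close>

lemma (in field_subring) Span_subset_span_over:
  "ring.Span ambient R Us \<subseteq> span_over R (set Us)"
proof -
  interpret ring "ambient :: 'a ring" by (rule ring_from_type_algebra)
  show ?thesis
  proof (induction Us)
    case (Cons u Us)
    have "line_extension R u (Span R Us) \<subseteq> span_over R (set (u # Us))"
    proof
      fix x assume "x \<in> line_extension R u (Span R Us)"
      then obtain k v where "k \<in> R" "v \<in> Span R Us" "x = k * u + v"
        unfolding line_extension_mem_iff by auto
      moreover have "v \<in> span_over R (set (u # Us))"
        using Cons.IH \<open>v \<in> Span R Us\<close> span_over_mono[of "set Us" "set (u # Us)"] by auto
      ultimately show "x \<in> span_over R (set (u # Us))" by (auto intro: span_over_step)
    qed
    then show ?case by simp
  qed auto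
qed

lemma separable_dedekind_extensionI:
  assumes "dedekind_domain A" "\<not> Ring.field (ring_on A)" "finite_separable_extension (fractions A)"
  obtains t where "separable_dedekind_extension A t"
proof -
  interpret dedekind_ring A using assms(1) by (rule dedekind_ring_of_dedekind_domain)
  interpret K: field_subfield "fractions A" by (rule field_subfield_fractions)
  \<comment> \<open>Without such an element every nonzero element of \<open>A\<close> would have its
    inverse in \<open>A\<close>, and \<open>A\<close> would be a field.\<close>
  obtain t where t: "t \<in> A" "t \<noteq> 0" "inverse t \<notin> A" using field_ring_on assms(2) by blast
  interpret ring "ambient :: 'a ring" by (rule ring_from_type_algebra)
  have "subfield (fractions A) ambient" "finite_dimension (fractions A) UNIV"
    and sep: "\<And>x. separable_element (fractions A) x"
    using assms(3) by (auto simp: finite_separable_extension_def)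
  then obtain Us where "Span (fractions A) Us = UNIV"
    using exists_base unfolding finite_dimension_def by blast
  then have "span_over (fractions A) (set Us) = UNIV" using K.Span_subset_span_over[of Us] by blast
  then have "separable_dedekind_extension A t"
    by unfold_locales (use t sep in blast)+
  then show ?thesis by (rule that)
qed

text \<open>Shows that multiplying a module by \<open>x\<close> is multiplication by a principal
  fractional ideal, so the ideal class is unchanged.\<close>

lemma (in field_subring) ideal_prod_principal:
  assumes "submodule_over R J"
  shows "ideal_prod ambient ((\<lambda>r. x * r) ` R) J = (\<lambda>j. x * j) ` J"
proof
  show "ideal_prod ambient ((\<lambda>r. x * r) ` R) J \<subseteq> (\<lambda>j. x * j) ` J"
  proof
    fix y assume "y \<in> ideal_prod ambient ((\<lambda>r. x * r) ` R) J"
    then show "y \<in> (\<lambda>j. x * j) ` J"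
    proof (induction rule: ideal_prod.induct)
      case (prod i j)
      then obtain r where "r \<in> R" "i = x * r" by blast
      then show ?case using submodule_scale[OF assms, of r j] prod by (auto simp: mult.assoc)
    next
      case (sum s1 s2)
      then show ?case using submodule_add[OF assms] by (auto simp flip: distrib_left)
    qed
  qed
  show "(\<lambda>j. x * j) ` J \<subseteq> ideal_prod ambient ((\<lambda>r. x * r) ` R) J"
  proof
    fix y assume "y \<in> (\<lambda>j. x * j) ` J"
    then obtain j where j: "j \<in> J" "y = x * j" by blast
    have "x * 1 \<in> (\<lambda>r. x * r) ` R" by blast
    then have "(x * 1) \<otimes>\<^bsub>ambient\<^esub> j \<in> ideal_prod ambient ((\<lambda>r. x * r) ` R) J"
      using j(1) by (rule ideal_prod.prod)
    then show "y \<in> ideal_prod ambient ((\<lambda>r. x * r) ` R) J" using j(2) by simp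
  qed
qed

theorem corollary2p8:
  fixes A K B :: "'l::field set"
  assumes "dedekind_domain A"
    and "\<not> Ring.field (ring_on A)"
    and "K = fractions A"
    and "finite_separable_extension K"
    and "B = integral_closure A"
  shows "\<forall>C \<in> carrier (ideal_class_group B). \<exists>\<bb> \<in> C. degree_one_ideal A B \<bb>"
proof
  fix C assume C: "C \<in> carrier (ideal_class_group B)"
  obtain t where "separable_dedekind_extension A t"
    using separable_dedekind_extensionI assms(1,2,4) unfolding assms(3) by blast
  then interpret E: separable_dedekind_extension A t .
  interpret R: field_subring B unfolding assms(5) by (rule E.field_subring_integral_closure)
  \<comment> \<open>A class is a coset of the principal fractional ideals, and \<open>J\<close> is a
    representative of it.\<close>
  obtain J where J: "fractional_ideal B J" "J \<noteq> {0}"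
    and CJ: "C = principal_fractional_ideals B #>\<^bsub>fractional_ideal_group B\<^esub> J"
    using C by (auto simp: ideal_class_group_def FactGroup_def RCOSETS_def fractional_ideal_group_def)
  interpret J: additive_subgroup J "ambient :: 'l ring"
    using J(1) by (simp add: fractional_ideal_def)
  have mJ: "submodule_over B J"
    using J(1) J.zero_closed J.a_closed by (intro submodule_overI) (auto simp: fractional_ideal_def)
  obtain e where e: "e \<noteq> 0" "\<And>j. j \<in> J \<Longrightarrow> e * j \<in> B"
    using J(1) by (auto simp: fractional_ideal_def)
  obtain x where x: "x \<noteq> 0" "\<And>j. j \<in> J \<Longrightarrow> x * j \<in> B"
    "\<And>y. y \<in> B \<Longrightarrow> \<exists>a\<in>A. \<exists>j\<in>J. y = a + x * j"
    using E.degree_one_multiple[of J e] mJ J(2) e unfolding assms(5) by metis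
  define \<bb> where "\<bb> = (\<lambda>j. x * j) ` J"
  \<comment> \<open>An integral multiple of \<open>x\<close> writes it as a fraction, so that it
    generates a principal fractional ideal of \<open>B\<close>.\<close>
  have "x \<in> fractions B"
  proof -
    obtain a where "a \<in> A" "a \<noteq> 0" "a * x \<in> B"
      using E.integral_multiple[of x] unfolding assms(5) by blast
    then have "x = (a * x) / a" "a \<in> B" "a * x \<in> B" "a \<noteq> 0"
      using E.subset_integral_closure by (auto simp: assms(5))
    then show ?thesis unfolding fractions_def by blast
  qed
  then have "(\<lambda>r. x * r) ` B \<in> principal_fractional_ideals B"
    using x(1) by (auto simp: principal_fractional_ideals_def)
  then have "\<bb> \<in> C"
    unfolding CJ r_coset_def \<bb>_def R.ideal_prod_principal[OF mJ, symmetric]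
    by (auto simp: fractional_ideal_group_def)
  moreover have "degree_one_ideal A B \<bb>"
  proof -
    have "submodule_over B \<bb>" unfolding \<bb>_def using mJ by (rule submodule_image_mult)
    moreover have bB: "\<bb> \<subseteq> B" using x(2) by (auto simp: \<bb>_def)
    ultimately have "ideal \<bb> (ring_on B)" by (simp add: R.ideal_ring_on_iff)
    moreover have "A <+>\<^bsub>ambient\<^esub> \<bb> = B"
    proof
      have "A \<subseteq> B" unfolding assms(5) by (rule E.subset_integral_closure)
      then show "A <+>\<^bsub>ambient\<^esub> \<bb> \<subseteq> B" using bB by (auto simp: set_add_def')
      show "B \<subseteq> A <+>\<^bsub>ambient\<^esub> \<bb>"
      proof
        fix y assume "y \<in> B"
        then obtain a j where "a \<in> A" "j \<in> J" "y = a + x * j" using x(3) by blast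
        then show "y \<in> A <+>\<^bsub>ambient\<^esub> \<bb>" by (auto simp: set_add_def' \<bb>_def)
      qed
    qed
    ultimately show ?thesis by (simp add: degree_one_ideal_def)
  qed
  ultimately show "\<exists>\<bb> \<in> C. degree_one_ideal A B \<bb>" by blast
qed

end
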